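(* There is a quasi-Banach space $\mathbb{X}$ with an almost greedy Schauder basis $\mathcal{X}=(\boldsymbol{x}_n)_{n=1}^\infty$ whose Banach envelope $\widehat{\mathcal{X}}=(J_{\mathbb{X}}(\boldsymbol{x}_n))_{n=1}^\infty$ (a sequence in the Banach envelope $\widehat{\mathbb{X}}$) is democratic and fails to be unconditional for constant coefficients. Moreover, there are constants $0<c\le C<\infty$ such that for every finite $A\subset\mathbb{N}$ \[ c|A|\le \Big\|\sum_{n\in A}\boldsymbol{x}_n\Big\|_{\mathbb{X}}\le C|A|,\qquad c|A|\le \Big\|\sum_{n\in A}J_{\mathbb{X}}(\boldsymbol{x}_n)\Big\|_{\widehat{\mathbb{X}}}\le C|A|, \] and $\mathbb{X}$ is locally $p$-convex for all $0<p<1$.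
   Context: Scalars are $\mathbb{F}=\mathbb{R}$ or $\mathbb{C}$; $S_{\mathbb{F}}=\{t\in\mathbb{F}:|t|=1\}$. A quasi-norm satisfies the norm axioms except that the triangle inequality is weakened to $\|f+g\|\le\kappa(\|f\|+\|g\|)$; a quasi-Banach space is a complete quasi-normed space. $\mathbb{X}$ is locally $p$-convex if there is a constant $C$ with $\|\sum_{j\in J}f_j\|\le C(\sum_{j\in J}\|f_j\|^p)^{1/p}$ for all finite families $(f_j)_{j\in J}$ in $\mathbb{X}$. Banach envelope: a Banach space $\widehat{\mathbb{X}}$ with a linear contraction $J_{\mathbb{X}}\colon\mathbb{X}\to\widehat{\mathbb{X}}$ such that for every Banach space $\mathbb{Y}$ and every continuous linear $T\colon\mathbb{X}\to\mathbb{Y}$ there is a unique continuous linear $\widehat{T}\colon\widehat{\mathbb{X}}\to\mathbb{Y}$ with $\widehat{T}\circ J_{\mathbb{X}}=T$, and $\|\widehat T\|\le\|T\|$. Concretely, if $\|\cdot\|_c$ is the Minkowski functional of the convex hull of the unit ball of $\mathbb{X}$ and $N=\{f:\|f\|_c=0\}$, then $\widehat{\mathbb{X}}$ is the completion of $(\mathbb{X}/N,\|\cdot\|_c)$. A minimal system in $\mathbb{X}$ is a sequence $(\boldsymbol{x}_n)$ for which there are $\boldsymbol{x}_n^*\in\mathbb{X}^*$ with $\boldsymbol{x}_n^*(\boldsymbol{x}_k)=\delta_{n,k}$; it is complete if its closed linear span is $\mathbb{X}$. A $W$-basis is a complete minimal system that is semi-normalized ($0<\inf_n\|\boldsymbol{x}_n\|\le\sup_n\|\boldsymbol{x}_n\|<\infty$)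 and $M$-bounded ($\sup_n\|\boldsymbol{x}_n\|\,\|\boldsymbol{x}_n^*\|<\infty$). For finite $A\subset\mathbb{N}$, $S_A(f)=\sum_{n\in A}\boldsymbol{x}_n^*(f)\boldsymbol{x}_n$. A finite set $A\subset\mathbb{N}$ is a greedy set of $f$ if $|\boldsymbol{x}_n^*(f)|\ge|\boldsymbol{x}_k^*(f)|$ for all $n\in A$, $k\in\mathbb{N}\setminus A$. A $W$-basis is almost greedy if there is $C$ such that $\|f-S_A(f)\|\le C\|f-S_B(f)\|$ for all $f\in\mathbb{X}$, all greedy sets $A$ of $f$ and all finite $B\subset\mathbb{N}$ with $|B|\le|A|$. A Schauder basis is a sequence such that every $f\in\mathbb{X}$ has a unique expansion $f=\sum_{n=1}^\infty a_n\boldsymbol{x}_n$ (convergent series). A sequence $(\boldsymbol{x}_n)$ is democratic if there is $C$ with $\|\sum_{n\in A}\boldsymbol{x}_n\|\le C\|\sum_{n\in B}\boldsymbol{x}_n\|$ for all finite $A,B\subset\mathbb{N}$ with $|A|\le|B|$. It is unconditional for constant coefficients if there is $C$ with $\|\sum_{n\in A}\varepsilon_n\boldsymbol{x}_n\|\le C\|\sum_{n\in B}\varepsilon_n\boldsymbol{x}_n\|$ for all finite $B\subset\mathbb{N}$, all $A\subset B$ and all $(\varepsilon_n)_{n\in B}\in S_{\mathbb{F}}^B$. *)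

theory Defs
  imports "HOL-Analysis.Analysis" "HOL-Library.Function_Algebras"
begin

section \<open>Quasi-normed spaces\<close>

text \<open>
  A space is a linear subspace \<open>carr X\<close> of an ambient vector space, with the scalar multiplication
  and the quasi-norm given explicitly, so that spaces can be quantified existentially.
  Only the values of \<open>qnorm X\<close> on \<open>carr X\<close> matter. The scalar field is a type \<open>'f\<close>, meant to be
  the reals or the complex numbers.
\<close>

record ('f, 'v) qspace =
  scal :: "'f \<Rightarrow> 'v \<Rightarrow> 'v"
  carr :: "'v set"
  qnorm :: "'v \<Rightarrow> real"

type_synonym 'f seq_qspace = "('f, nat \<Rightarrow> 'f) qspace"

definition quasi_normed :: "('f::real_normed_field, 'v::ab_group_add) qspace \<Rightarrow> real \<Rightarrow> bool" where
  "quasi_normed X \<kappa> \<longleftrightarrow>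
     vector_space (scal X) \<and> module.subspace (scal X) (carr X) \<and>
     (\<forall>f\<in>carr X. 0 \<le> qnorm X f) \<and>
     (\<forall>f\<in>carr X. qnorm X f = 0 \<longleftrightarrow> f = 0) \<and>
     (\<forall>c. \<forall>f\<in>carr X. qnorm X (scal X c f) = norm c * qnorm X f) \<and>
     (\<forall>f\<in>carr X. \<forall>g\<in>carr X. qnorm X (f + g) \<le> \<kappa> * (qnorm X f + qnorm X g))"

definition converges_in ::
  "('f, 'v::ab_group_add) qspace \<Rightarrow> (nat \<Rightarrow> 'v) \<Rightarrow> 'v \<Rightarrow> bool" where
  "converges_in X u f \<longleftrightarrow> (\<lambda>n. qnorm X (u n - f)) \<longlonglongrightarrow> 0"

definition complete_space_on :: "('f, 'v::ab_group_add) qspace \<Rightarrow> bool" where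
  "complete_space_on X \<longleftrightarrow>
     (\<forall>u. range u \<subseteq> carr X \<and> (\<forall>e>0. \<exists>M. \<forall>m\<ge>M. \<forall>n\<ge>M. qnorm X (u m - u n) < e)
        \<longrightarrow> (\<exists>f\<in>carr X. converges_in X u f))"

definition quasi_banach_space :: "('f::real_normed_field, 'v::ab_group_add) qspace \<Rightarrow> bool" where
  "quasi_banach_space X \<longleftrightarrow> (\<exists>\<kappa>. quasi_normed X \<kappa>) \<and> complete_space_on X"

definition banach_space :: "('f::real_normed_field, 'v::ab_group_add) qspace \<Rightarrow> bool" where
  "banach_space X \<longleftrightarrow> quasi_normed X 1 \<and> complete_space_on X"

definition locally_p_convex :: "real \<Rightarrow> ('f, 'v::ab_group_add) qspace \<Rightarrow> bool" where
  "locally_p_convex p X \<longleftrightarrow>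
     (\<exists>C. \<forall>J :: nat set. \<forall>f. finite J \<and> f ` J \<subseteq> carr X \<longrightarrow>
        qnorm X (\<Sum>j\<in>J. f j) \<le> C * (\<Sum>j\<in>J. qnorm X (f j) powr p) powr (1 / p))"

section \<open>Continuous linear maps\<close>

definition linear_betw ::
  "('f, 'v::ab_group_add) qspace \<Rightarrow> ('f, 'w::ab_group_add) qspace \<Rightarrow> ('v \<Rightarrow> 'w) \<Rightarrow> bool" where
  "linear_betw X Y T \<longleftrightarrow>
     T ` carr X \<subseteq> carr Y \<and>
     (\<forall>f\<in>carr X. \<forall>g\<in>carr X. T (f + g) = T f + T g) \<and>
     (\<forall>c. \<forall>f\<in>carr X. T (scal X c f) = scal Y c (T f))"

text \<open>For linear maps between quasi-normed spaces, continuity is boundedness.\<close>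

definition cont_linear ::
  "('f, 'v::ab_group_add) qspace \<Rightarrow> ('f, 'w::ab_group_add) qspace \<Rightarrow> ('v \<Rightarrow> 'w) \<Rightarrow> bool" where
  "cont_linear X Y T \<longleftrightarrow>
     linear_betw X Y T \<and> (\<exists>C. \<forall>f\<in>carr X. qnorm Y (T f) \<le> C * qnorm X f)"

definition op_norm ::
  "('f, 'v) qspace \<Rightarrow> ('f, 'w) qspace \<Rightarrow> ('v \<Rightarrow> 'w) \<Rightarrow> real" where
  "op_norm X Y T = (SUP f\<in>{f \<in> carr X. qnorm X f \<le> 1}. qnorm Y (T f))"

definition scalars :: "('f::real_normed_field, 'f) qspace" where
  "scalars = \<lparr>scal = (*), carr = UNIV, qnorm = norm\<rparr>"

section \<open>The Banach envelope\<close>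

definition convex_in :: "('f::real_normed_field, 'v::ab_group_add) qspace \<Rightarrow> 'v set \<Rightarrow> bool" where
  "convex_in X K \<longleftrightarrow>
     (\<forall>f\<in>K. \<forall>g\<in>K. \<forall>a b :: real. 0 \<le> a \<and> 0 \<le> b \<and> a + b = 1 \<longrightarrow>
        scal X (of_real a) f + scal X (of_real b) g \<in> K)"

text \<open>The Minkowski functional of the convex hull of the unit ball.\<close>

definition env_norm :: "('f::real_normed_field, 'v::ab_group_add) qspace \<Rightarrow> 'v \<Rightarrow> real" where
  "env_norm X f =
     Inf {t. 0 < t \<and> scal X (of_real (inverse t)) f \<in> convex_in X hull {g \<in> carr X. qnorm X g \<le> 1}}"

text \<open>
  \<open>(E, J)\<close> is a completion of the quotient of \<open>X\<close> by the kernel of the seminorm \<open>env_norm X\<close>: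
  a linear \<open>J\<close> with \<open>qnorm E (J f) = env_norm X f\<close> is the same as a linear isometric embedding
  of that quotient into \<open>E\<close>. The universal property is the theorem
  \<open>banach_envelope_universal\<close> below.
\<close>

definition banach_envelope ::
  "('f::real_normed_field, 'v::ab_group_add) qspace \<Rightarrow> ('f, 'w::ab_group_add) qspace \<Rightarrow> ('v \<Rightarrow> 'w) \<Rightarrow> bool"
  where
  "banach_envelope X E J \<longleftrightarrow>
     banach_space E \<and> linear_betw X E J \<and>
     (\<forall>f\<in>carr X. qnorm E (J f) = env_norm X f) \<and>
     (\<forall>g\<in>carr E. \<forall>e>0. \<exists>f\<in>carr X. qnorm E (g - J f) < e)"

section \<open>Bases\<close>

text \<open>Sequences are indexed from 0.\<close>

definition minimal_system ::
  "('f::real_normed_field, 'v::ab_group_add) qspace \<Rightarrow> (nat \<Rightarrow> 'v) \<Rightarrow> (nat \<Rightarrow> 'v \<Rightarrow> 'f) \<Rightarrow> bool" where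
  "minimal_system X x xs \<longleftrightarrow>
     range x \<subseteq> carr X \<and> (\<forall>n. cont_linear X scalars (xs n)) \<and>
     (\<forall>n k. xs n (x k) = (if n = k then 1 else 0))"

definition complete_system ::
  "('f::real_normed_field, 'v::ab_group_add) qspace \<Rightarrow> (nat \<Rightarrow> 'v) \<Rightarrow> bool" where
  "complete_system X x \<longleftrightarrow>
     (\<forall>f\<in>carr X. \<forall>e>0. \<exists>g \<in> module.span (scal X) (range x). qnorm X (f - g) < e)"

definition semi_normalized :: "('f, 'v) qspace \<Rightarrow> (nat \<Rightarrow> 'v) \<Rightarrow> bool" where
  "semi_normalized X x \<longleftrightarrow>
     0 < (INF n. qnorm X (x n)) \<and> bdd_above (range (\<lambda>n. qnorm X (x n)))"

definition M_bounded ::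
  "('f::real_normed_field, 'v) qspace \<Rightarrow> (nat \<Rightarrow> 'v) \<Rightarrow> (nat \<Rightarrow> 'v \<Rightarrow> 'f) \<Rightarrow> bool" where
  "M_bounded X x xs \<longleftrightarrow> bdd_above (range (\<lambda>n. qnorm X (x n) * op_norm X scalars (xs n)))"

text \<open>
  The coordinate functionals \<open>xs\<close> are determined by \<open>x\<close> on the space, since the system is complete.
\<close>

definition W_basis ::
  "('f::real_normed_field, 'v::ab_group_add) qspace \<Rightarrow> (nat \<Rightarrow> 'v) \<Rightarrow> (nat \<Rightarrow> 'v \<Rightarrow> 'f) \<Rightarrow> bool" where
  "W_basis X x xs \<longleftrightarrow>
     minimal_system X x xs \<and> complete_system X x \<and> semi_normalized X x \<and> M_bounded X x xs"

definition coord_proj ::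
  "('f, 'v::ab_group_add) qspace \<Rightarrow> (nat \<Rightarrow> 'v) \<Rightarrow> (nat \<Rightarrow> 'v \<Rightarrow> 'f) \<Rightarrow> nat set \<Rightarrow> 'v \<Rightarrow> 'v" where
  "coord_proj X x xs A f = (\<Sum>n\<in>A. scal X (xs n f) (x n))"

definition greedy_set :: "(nat \<Rightarrow> 'v \<Rightarrow> 'f::real_normed_field) \<Rightarrow> 'v \<Rightarrow> nat set \<Rightarrow> bool" where
  "greedy_set xs f A \<longleftrightarrow> finite A \<and> (\<forall>n\<in>A. \<forall>k. k \<notin> A \<longrightarrow> norm (xs k f) \<le> norm (xs n f))"

definition almost_greedy_basis ::
  "('f::real_normed_field, 'v::ab_group_add) qspace \<Rightarrow> (nat \<Rightarrow> 'v) \<Rightarrow> bool" where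
  "almost_greedy_basis X x \<longleftrightarrow>
     (\<exists>xs. W_basis X x xs \<and>
       (\<exists>C. \<forall>f\<in>carr X. \<forall>A B. greedy_set xs f A \<and> finite B \<and> card B \<le> card A \<longrightarrow>
          qnorm X (f - coord_proj X x xs A f) \<le> C * qnorm X (f - coord_proj X x xs B f)))"

definition schauder_basis :: "('f, 'v::ab_group_add) qspace \<Rightarrow> (nat \<Rightarrow> 'v) \<Rightarrow> bool" where
  "schauder_basis X x \<longleftrightarrow>
     range x \<subseteq> carr X \<and>
     (\<forall>f\<in>carr X. \<exists>!a. converges_in X (\<lambda>N. \<Sum>n<N. scal X (a n) (x n)) f)"

definition democratic :: "('f, 'v::ab_group_add) qspace \<Rightarrow> (nat \<Rightarrow> 'v) \<Rightarrow> bool" where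
  "democratic X x \<longleftrightarrow>
     (\<exists>C. \<forall>A B. finite A \<and> finite B \<and> card A \<le> card B \<longrightarrow>
        qnorm X (\<Sum>n\<in>A. x n) \<le> C * qnorm X (\<Sum>n\<in>B. x n))"

definition unconditional_const_coeffs ::
  "('f::real_normed_field, 'v::ab_group_add) qspace \<Rightarrow> (nat \<Rightarrow> 'v) \<Rightarrow> bool" where
  "unconditional_const_coeffs X x \<longleftrightarrow>
     (\<exists>C. \<forall>A B. \<forall>\<epsilon> :: nat \<Rightarrow> 'f. finite B \<and> A \<subseteq> B \<and> (\<forall>n\<in>B. norm (\<epsilon> n) = 1) \<longrightarrow>
        qnorm X (\<Sum>n\<in>A. scal X (\<epsilon> n) (x n)) \<le> C * qnorm X (\<Sum>n\<in>B. scal X (\<epsilon> n) (x n)))"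

section \<open>The universal property of the Banach envelope\<close>

lemma subspace_closed:
  fixes X :: "('f::real_normed_field, 'v::ab_group_add) qspace"
  assumes "quasi_normed X k"
  shows "0 \<in> carr X"
    and "f \<in> carr X \<Longrightarrow> g \<in> carr X \<Longrightarrow> f + g \<in> carr X"
    and "f \<in> carr X \<Longrightarrow> g \<in> carr X \<Longrightarrow> f - g \<in> carr X"
    and "f \<in> carr X \<Longrightarrow> scal X c f \<in> carr X"
proof -
  interpret V: vector_space "scal X" using assms by (simp add: quasi_normed_def)
  have s: "V.subspace (carr X)" using assms by (simp add: quasi_normed_def)
  show "0 \<in> carr X" using s by (rule V.subspace_0)
  show "f \<in> carr X \<Longrightarrow> g \<in> carr X \<Longrightarrow> f + g \<in> carr X" using s by (rule V.subspace_add)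
  show "f \<in> carr X \<Longrightarrow> g \<in> carr X \<Longrightarrow> f - g \<in> carr X" using s by (rule V.subspace_diff)
  show "f \<in> carr X \<Longrightarrow> scal X c f \<in> carr X" using s by (rule V.subspace_scale)
qed

lemma quasi_normedD:
  fixes X :: "('f::real_normed_field, 'v::ab_group_add) qspace"
  assumes "quasi_normed X k" "f \<in> carr X"
  shows "0 \<le> qnorm X f"
    and "qnorm X f = 0 \<longleftrightarrow> f = 0"
    and "qnorm X (scal X c f) = norm c * qnorm X f"
    and "g \<in> carr X \<Longrightarrow> qnorm X (f + g) \<le> k * (qnorm X f + qnorm X g)"
  using assms by (simp_all add: quasi_normed_def)

lemma linear_betw_diff:
  fixes X :: "('f::real_normed_field, 'v::ab_group_add) qspace"
    and Y :: "('f, 'w::ab_group_add) qspace"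
  assumes "quasi_normed X k" "linear_betw X Y T" "f \<in> carr X" "g \<in> carr X"
  shows "T (f - g) = T f - T g"
proof -
  have "T ((f - g) + g) = T (f - g) + T g"
    using assms subspace_closed[OF assms(1)] unfolding linear_betw_def by blast
  then show ?thesis by simp
qed

lemma env_norm_set_nonempty:
  fixes X :: "('f::real_normed_field, 'v::ab_group_add) qspace"
  assumes X: "quasi_normed X k" and f: "f \<in> carr X" and t: "0 < t" "qnorm X f \<le> t"
  shows "scal X (of_real (inverse t)) f \<in> convex_in X hull {g \<in> carr X. qnorm X g \<le> 1}"
proof -
  have "qnorm X (scal X (of_real (inverse t)) f) = norm (of_real (inverse t) :: 'f) * qnorm X f"
    by (rule quasi_normedD(3)[OF X f])
  also have "norm (of_real (inverse t) :: 'f) = inverse t"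
    using t(1) by (simp only: norm_of_real) simp
  also have "inverse t * qnorm X f \<le> 1" using t by (simp add: field_simps)
  finally have "scal X (of_real (inverse t)) f \<in> {g \<in> carr X. qnorm X g \<le> 1}"
    using subspace_closed(4)[OF X f] by simp
  then show ?thesis by (rule hull_inc)
qed

lemma env_norm_le:
  fixes X :: "('f::real_normed_field, 'v::ab_group_add) qspace"
  assumes X: "quasi_normed X k" and f: "f \<in> carr X"
  shows "env_norm X f \<le> qnorm X f"
proof (rule field_le_epsilon)
  fix e :: real assume e: "0 < e"
  have nn: "0 \<le> qnorm X f" using X f by (simp add: quasi_normed_def)
  show "env_norm X f \<le> qnorm X f + e" unfolding env_norm_def
  proof (rule cInf_lower)
    show "qnorm X f + e \<in> {t. 0 < t \<and>
        scal X (of_real (inverse t)) f \<in> convex_in X hull {g \<in> carr X. qnorm X g \<le> 1}}"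
      using env_norm_set_nonempty[OF X f, of "qnorm X f + e"] nn e by simp
  qed (auto intro!: bdd_belowI[of _ 0])
qed

lemma bound_env_norm:
  fixes X :: "('f::real_normed_field, 'v::ab_group_add) qspace"
    and Y :: "('f, 'w::ab_group_add) qspace"
  assumes X: "quasi_normed X k" and Y: "quasi_normed Y 1"
    and T: "linear_betw X Y T" and C: "0 \<le> C"
    and bd: "\<And>f. f \<in> carr X \<Longrightarrow> qnorm X f \<le> 1 \<Longrightarrow> qnorm Y (T f) \<le> C"
    and f: "f \<in> carr X"
  shows "qnorm Y (T f) \<le> C * env_norm X f"
proof -
  interpret V: vector_space "scal X" using X by (simp add: quasi_normed_def)
  let ?B = "{g \<in> carr X. qnorm X g \<le> 1}"
  let ?K = "{g \<in> carr X. qnorm Y (T g) \<le> C}"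
  have TY: "T g \<in> carr Y" if "g \<in> carr X" for g using T that unfolding linear_betw_def by blast
  have scT: "qnorm Y (T (scal X c g)) = norm c * qnorm Y (T g)" if "g \<in> carr X" for c g
    using T that quasi_normedD(3)[OF Y TY[OF that]] unfolding linear_betw_def by simp
  have "convex_in X ?K" unfolding convex_in_def
  proof (intro ballI allI impI)
    fix g h and a b :: real
    assume g: "g \<in> ?K" and h: "h \<in> ?K" and ab: "0 \<le> a \<and> 0 \<le> b \<and> a + b = 1"
    let ?g = "scal X (of_real a) g" and ?h = "scal X (of_real b) h"
    have gh: "?g \<in> carr X" "?h \<in> carr X" using g h subspace_closed(4)[OF X] by auto
    have "qnorm Y (T (?g + ?h)) = qnorm Y (T ?g + T ?h)"
      using T gh unfolding linear_betw_def by simp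
    also have "\<dots> \<le> qnorm Y (T ?g) + qnorm Y (T ?h)"
      using quasi_normedD(4)[OF Y TY[OF gh(1)] TY[OF gh(2)]] by simp
    also have "\<dots> = a * qnorm Y (T g) + b * qnorm Y (T h)"
      using scT g h ab by simp
    also have "\<dots> \<le> a * C + b * C" using g h ab by (intro add_mono mult_left_mono) auto
    also have "\<dots> = C" using ab by (simp flip: distrib_right)
    finally show "?g + ?h \<in> ?K" using subspace_closed(2)[OF X gh] by simp
  qed
  then have sub: "convex_in X hull ?B \<subseteq> ?K" by (intro hull_minimal) (auto intro: bd)
  let ?S = "{t. 0 < t \<and> scal X (of_real (inverse t)) f \<in> convex_in X hull ?B}"
  have le: "qnorm Y (T f) \<le> C * t" if "t \<in> ?S" for t
  proof -
    have "qnorm Y (T (scal X (of_real (inverse t)) f)) \<le> C" using that sub by blast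
    moreover have "norm (of_real (inverse t) :: 'f) = inverse t"
      using that by (simp only: norm_of_real) simp
    ultimately have "inverse t * qnorm Y (T f) \<le> C" by (simp only: scT[OF f])
    then show ?thesis using that by (simp add: field_simps)
  qed
  have nn: "0 \<le> qnorm X f" using X f by (simp add: quasi_normed_def)
  have "qnorm X f + 1 \<in> ?S"
    using env_norm_set_nonempty[OF X f, of "qnorm X f + 1"] nn by simp
  then have ne: "?S \<noteq> {}" by (metis empty_iff)
  show ?thesis
  proof (cases "C = 0")
    case True
    then show ?thesis using le[OF \<open>qnorm X f + 1 \<in> ?S\<close>] by simp
  next
    case False
    then have "qnorm Y (T f) / C \<le> t" if "t \<in> ?S" for t
      using le[OF that] C by (simp add: field_simps)
    then have "qnorm Y (T f) / C \<le> env_norm X f"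
      unfolding env_norm_def using ne by (intro cInf_greatest) auto
    then show ?thesis using False C by (simp add: field_simps)
  qed
qed

lemma norm_dist:
  fixes Y :: "('f::real_normed_field, 'w::ab_group_add) qspace"
  assumes Y: "quasi_normed Y 1" and "a \<in> carr Y" "b \<in> carr Y" "c \<in> carr Y"
  shows norm_dist_commute: "qnorm Y (a - b) = qnorm Y (b - a)"
    and norm_dist_triangle: "qnorm Y (a - b) \<le> qnorm Y (a - c) + qnorm Y (c - b)"
proof -
  interpret V: vector_space "scal Y" using Y by (simp add: quasi_normed_def)
  have m: "\<And>f g. f \<in> carr Y \<Longrightarrow> g \<in> carr Y \<Longrightarrow> f - g \<in> carr Y"
    by (rule subspace_closed(3)[OF Y])
  have "qnorm Y (scal Y (- 1) (b - a)) = norm (- 1 :: 'f) * qnorm Y (b - a)"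
    by (rule quasi_normedD(3)[OF Y m]) (use assms in auto)
  then show "qnorm Y (a - b) = qnorm Y (b - a)" by simp
  have "qnorm Y ((a - c) + (c - b)) \<le> 1 * (qnorm Y (a - c) + qnorm Y (c - b))"
    by (rule quasi_normedD(4)[OF Y m m]) (use assms in auto)
  then show "qnorm Y (a - b) \<le> qnorm Y (a - c) + qnorm Y (c - b)" by simp
qed

lemma norm_add_le:
  fixes Y :: "('f::real_normed_field, 'w::ab_group_add) qspace"
  assumes Y: "quasi_normed Y 1" and "a \<in> carr Y" "b \<in> carr Y"
  shows "qnorm Y (a + b) \<le> qnorm Y a + qnorm Y b"
  using quasi_normedD(4)[OF assms] by simp

lemma eq_if_small:
  fixes Y :: "('f::real_normed_field, 'w::ab_group_add) qspace"
  assumes Y: "quasi_normed Y 1" and ab: "a \<in> carr Y" "b \<in> carr Y"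
    and small: "\<And>e. 0 < e \<Longrightarrow> qnorm Y (a - b) \<le> K * e"
  shows "a = b"
proof -
  have d: "a - b \<in> carr Y" using subspace_closed(3)[OF Y] ab by blast
  have "qnorm Y (a - b) \<le> 0"
  proof (rule field_le_epsilon)
    fix e :: real assume e: "0 < e"
    have "qnorm Y (a - b) \<le> K * (e / (\<bar>K\<bar> + 1))" using e by (intro small) simp
    also have "\<dots> \<le> (\<bar>K\<bar> + 1) * (e / (\<bar>K\<bar> + 1))" using e by (intro mult_right_mono) auto
    also have "\<dots> = e" by simp
    finally show "qnorm Y (a - b) \<le> 0 + e" by simp
  qed
  moreover have "0 \<le> qnorm Y (a - b)" by (rule quasi_normedD(1)[OF Y d])
  ultimately have "qnorm Y (a - b) = 0" by simp
  then have "a - b = 0" by (rule iffD1[OF quasi_normedD(2)[OF Y d]])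
  then show ?thesis by simp
qed

theorem banach_envelope_contraction:
  fixes X :: "('f::real_normed_field, 'v::ab_group_add) qspace"
    and E :: "('f, 'w::ab_group_add) qspace"
  assumes "quasi_banach_space X" "banach_envelope X E J" "f \<in> carr X"
  shows "qnorm E (J f) \<le> qnorm X f"
proof -
  obtain k where k: "quasi_normed X k" using assms(1) unfolding quasi_banach_space_def by blast
  have "qnorm E (J f) = env_norm X f" using assms(2,3) by (simp add: banach_envelope_def)
  also have "\<dots> \<le> qnorm X f" using k assms(3) by (rule env_norm_le)
  finally show ?thesis .
qed

theorem banach_envelope_universal:
  fixes X :: "('f::real_normed_field, 'v::ab_group_add) qspace"
    and E :: "('f, 'w::ab_group_add) qspace"
    and Y :: "('f, 'y::ab_group_add) qspace"
  assumes X: "quasi_banach_space X" and E: "banach_envelope X E J"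
    and Y: "banach_space Y" and T: "cont_linear X Y T"
  shows "\<exists>Th. cont_linear E Y Th \<and> (\<forall>f\<in>carr X. Th (J f) = T f) \<and>
           op_norm E Y Th \<le> op_norm X Y T \<and>
           (\<forall>S. cont_linear E Y S \<and> (\<forall>f\<in>carr X. S (J f) = T f) \<longrightarrow> (\<forall>g\<in>carr E. S g = Th g))"
proof -
  obtain k where Xk: "quasi_normed X k" using X unfolding quasi_banach_space_def by blast
  have E1: "quasi_normed E 1" and Jl: "linear_betw X E J"
    using E by (simp_all add: banach_envelope_def banach_space_def)
  have Je: "qnorm E (J f) = env_norm X f" if "f \<in> carr X" for f
    using E that by (simp add: banach_envelope_def)
  have dense: "\<exists>f\<in>carr X. qnorm E (g - J f) < e" if "g \<in> carr E" "e > 0" for g e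
    using E that by (simp add: banach_envelope_def)
  have Y1: "quasi_normed Y 1" and Yc: "complete_space_on Y"
    using Y by (simp_all add: banach_space_def)
  have Tl: "linear_betw X Y T" using T by (simp add: cont_linear_def)
  have Jc: "J f \<in> carr E" if "f \<in> carr X" for f using Jl that unfolding linear_betw_def by blast
  have Tc: "T f \<in> carr Y" if "f \<in> carr X" for f using Tl that unfolding linear_betw_def by blast
  note Xcl = subspace_closed[OF Xk] and Ecl = subspace_closed[OF E1] and Ycl = subspace_closed[OF Y1]
  note Jd = linear_betw_diff[OF Xk Jl] and Td = linear_betw_diff[OF Xk Tl]
  have J0: "J 0 = 0" using Jd[of 0 0] Xcl(1) by simp
  have T0: "T 0 = 0" using Td[of 0 0] Xcl(1) by simp
  have e0: "qnorm E 0 = 0" using quasi_normedD(2)[OF E1 Ecl(1)] by simp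
  have y0: "qnorm Y 0 = 0" using quasi_normedD(2)[OF Y1 Ycl(1)] by simp
  have x0: "qnorm X 0 = 0" using quasi_normedD(2)[OF Xk Xcl(1)] by simp
  have Ynn: "0 \<le> qnorm Y a" if "a \<in> carr Y" for a
    by (rule quasi_normedD(1)[OF Y1 that])
  have Enn: "0 \<le> qnorm E a" if "a \<in> carr E" for a
    by (rule quasi_normedD(1)[OF E1 that])
  have Xnn: "0 \<le> qnorm X a" if "a \<in> carr X" for a
    by (rule quasi_normedD(1)[OF Xk that])
  define C where "C = op_norm X Y T"
  obtain C0 where C0: "\<And>f. f \<in> carr X \<Longrightarrow> qnorm Y (T f) \<le> C0 * qnorm X f"
    using T unfolding cont_linear_def by blast
  have bdd: "bdd_above ((\<lambda>f. qnorm Y (T f)) ` {f \<in> carr X. qnorm X f \<le> 1})"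
  proof (rule bdd_aboveI2[of _ _ "\<bar>C0\<bar>"])
    fix f assume f: "f \<in> {f \<in> carr X. qnorm X f \<le> 1}"
    have "qnorm Y (T f) \<le> C0 * qnorm X f" using C0 f by simp
    also have "\<dots> \<le> \<bar>C0\<bar> * 1" using f Xnn by (intro mult_mono) auto
    finally show "qnorm Y (T f) \<le> \<bar>C0\<bar>" by simp
  qed
  have Cbd: "qnorm Y (T f) \<le> C" if "f \<in> carr X" "qnorm X f \<le> 1" for f
    unfolding C_def op_norm_def using that bdd by (intro cSUP_upper) auto
  have C: "0 \<le> C" using Cbd[of 0] Xcl(1) x0 T0 y0 by simp
  have TJ: "qnorm Y (T f) \<le> C * qnorm E (J f)" if "f \<in> carr X" for f
    using bound_env_norm[OF Xk Y1 Tl C Cbd that] Je[OF that] by simp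
  have TJd: "qnorm Y (T f - T h) \<le> C * qnorm E (J f - J h)" if "f \<in> carr X" "h \<in> carr X" for f h
    using TJ[OF Xcl(3)[OF that]] Jd[OF that] Td[OF that] by simp
  have ex: "\<exists>y\<in>carr Y. \<forall>f\<in>carr X. qnorm Y (y - T f) \<le> C * qnorm E (g - J f)"
    if g: "g \<in> carr E" for g
  proof -
    have "\<forall>n. \<exists>f. f \<in> carr X \<and> qnorm E (g - J f) < 1 / real (Suc n)"
    proof
      fix n show "\<exists>f. f \<in> carr X \<and> qnorm E (g - J f) < 1 / real (Suc n)"
        using dense[OF g, of "1 / real (Suc n)"] by auto
    qed
    then obtain u where u: "\<And>n. u n \<in> carr X" "\<And>n. qnorm E (g - J (u n)) < 1 / real (Suc n)"
      by metis
    have d: "qnorm Y (T (u m) - T f) \<le> C * (1 / real (Suc m)) + C * qnorm E (g - J f)"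
      if f: "f \<in> carr X" for m f
    proof -
      have "qnorm E (J (u m) - J f) \<le> qnorm E (J (u m) - g) + qnorm E (g - J f)"
        by (rule norm_dist_triangle[OF E1]) (use Jc u f g in auto)
      also have "qnorm E (J (u m) - g) = qnorm E (g - J (u m))"
        by (rule norm_dist_commute[OF E1 _ _ g]) (use Jc u g in auto)
      also have "\<dots> \<le> 1 / real (Suc m)" using u(2)[of m] by simp
      finally have "C * qnorm E (J (u m) - J f) \<le> C * (1 / real (Suc m) + qnorm E (g - J f))"
        using C by (intro mult_left_mono) auto
      then show ?thesis using TJd[OF u(1)[of m] f] by (simp add: distrib_left)
    qed
    have "\<exists>M. \<forall>m\<ge>M. \<forall>n\<ge>M. qnorm Y (T (u m) - T (u n)) < e" if e: "e > 0" for e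
    proof -
      obtain M where "2 * C / e < real M" using reals_Archimedean2 by blast
      then have M: "2 * C / e < real (Suc M)" by simp
      have "qnorm Y (T (u m) - T (u n)) < e" if "M \<le> m" "M \<le> n" for m n
      proof -
        have "qnorm Y (T (u m) - T (u n)) \<le> C * (1 / real (Suc m)) + C * qnorm E (g - J (u n))"
          by (rule d[OF u(1)])
        also have "\<dots> \<le> C * (1 / real (Suc M)) + C * (1 / real (Suc M))"
        proof (intro add_mono mult_left_mono C)
          show "1 / real (Suc m) \<le> 1 / real (Suc M)" using that by (simp add: frac_le)
          have "qnorm E (g - J (u n)) \<le> 1 / real (Suc n)" using u(2)[of n] by simp
          also have "\<dots> \<le> 1 / real (Suc M)" using that by (simp add: frac_le)
          finally show "qnorm E (g - J (u n)) \<le> 1 / real (Suc M)" .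
        qed
        also have "\<dots> = 2 * C / real (Suc M)" by simp
        also have "\<dots> < e" using M e by (simp add: field_simps)
        finally show ?thesis .
      qed
      then show ?thesis by blast
    qed
    moreover have "range (\<lambda>n. T (u n)) \<subseteq> carr Y" using u Tc by auto
    ultimately obtain y where y: "y \<in> carr Y" "converges_in Y (\<lambda>n. T (u n)) y"
      using Yc unfolding complete_space_on_def by blast
    have "qnorm Y (y - T f) \<le> C * qnorm E (g - J f)" if f: "f \<in> carr X" for f
    proof (rule LIMSEQ_le_const)
      have "(\<lambda>n. 1 / real (Suc n)) \<longlonglongrightarrow> 0" using LIMSEQ_inverse_real_of_nat
        by (simp add: inverse_eq_divide)
      then have "(\<lambda>n. qnorm Y (T (u n) - y) + (C * (1 / real (Suc n)) + C * qnorm E (g - J f)))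
          \<longlonglongrightarrow> 0 + (C * 0 + C * qnorm E (g - J f))"
        using y(2) unfolding converges_in_def by (intro tendsto_intros)
      then show "(\<lambda>n. qnorm Y (T (u n) - y) + (C * (1 / real (Suc n)) + C * qnorm E (g - J f)))
          \<longlonglongrightarrow> C * qnorm E (g - J f)" by simp
      have "qnorm Y (y - T f) \<le> qnorm Y (T (u n) - y) + (C * (1 / real (Suc n)) + C * qnorm E (g - J f))"
        for n
      proof -
        have "qnorm Y (y - T f) \<le> qnorm Y (y - T (u n)) + qnorm Y (T (u n) - T f)"
          by (rule norm_dist_triangle[OF Y1]) (use Tc u f y in auto)
        also have "qnorm Y (y - T (u n)) = qnorm Y (T (u n) - y)"
          by (rule norm_dist_commute[OF Y1 _ _ y(1)]) (use Tc u y in auto)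
        finally show ?thesis using d[OF f, of n] by linarith
      qed
      then show "\<exists>N. \<forall>n\<ge>N. qnorm Y (y - T f)
          \<le> qnorm Y (T (u n) - y) + (C * (1 / real (Suc n)) + C * qnorm E (g - J f))" by blast
    qed
    then show ?thesis using y(1) by blast
  qed
  then obtain Th where Thc: "\<And>g. g \<in> carr E \<Longrightarrow> Th g \<in> carr Y"
    and Th: "\<And>g f. g \<in> carr E \<Longrightarrow> f \<in> carr X \<Longrightarrow> qnorm Y (Th g - T f) \<le> C * qnorm E (g - J f)"
    by metis
  have ext: "Th (J f) = T f" if f: "f \<in> carr X" for f
  proof (rule eq_if_small[OF Y1 Thc[OF Jc[OF f]] Tc[OF f], where K = 0])
    fix e :: real assume "0 < e"
    show "qnorm Y (Th (J f) - T f) \<le> 0 * e" using Th[OF Jc[OF f] f] e0 by simp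
  qed
  have Thb: "qnorm Y (Th g) \<le> C * qnorm E g" if g: "g \<in> carr E" for g
    using Th[OF g Xcl(1)] T0 J0 by simp
  have add: "Th (g + h) = Th g + Th h" if g: "g \<in> carr E" and h: "h \<in> carr E" for g h
  proof (rule eq_if_small[OF Y1 Thc[OF Ecl(2)[OF g h]] Ycl(2)[OF Thc[OF g] Thc[OF h]],
        where K = "4 * C"])
    fix e :: real assume e: "0 < e"
    obtain a where a: "a \<in> carr X" "qnorm E (g - J a) < e" using dense[OF g e] by blast
    obtain b where b: "b \<in> carr X" "qnorm E (h - J b) < e" using dense[OF h e] by blast
    have Jab: "J (a + b) = J a + J b" and Tab: "T (a + b) = T a + T b"
      using Jl Tl a b unfolding linear_betw_def by blast+
    have "qnorm Y (Th (g + h) - (Th g + Th h))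
        \<le> qnorm Y (Th (g + h) - T (a + b)) + qnorm Y (T (a + b) - (Th g + Th h))"
      by (rule norm_dist_triangle[OF Y1]) (use Thc Tc Ecl Ycl Xcl g h a b in auto)
    also have "qnorm Y (T (a + b) - (Th g + Th h)) = qnorm Y ((Th g + Th h) - T (a + b))"
      by (rule norm_dist_commute[OF Y1 _ _ Ycl(1)]) (use Thc Tc Ecl Ycl Xcl g h a b in auto)
    also have "\<dots> = qnorm Y ((Th g - T a) + (Th h - T b))"
      by (simp add: Tab algebra_simps)
    also have "\<dots> \<le> qnorm Y (Th g - T a) + qnorm Y (Th h - T b)"
      by (rule norm_add_le[OF Y1]) (use Thc Tc Ycl g h a b in auto)
    also have "qnorm Y (Th (g + h) - T (a + b)) \<le> C * (e + e)"
    proof -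
      have "qnorm E ((g + h) - J (a + b)) = qnorm E ((g - J a) + (h - J b))"
        by (simp add: Jab algebra_simps)
      also have "\<dots> \<le> qnorm E (g - J a) + qnorm E (h - J b)"
        by (rule norm_add_le[OF E1]) (use Jc Ecl g h a b in auto)
      also have "\<dots> \<le> e + e" using a b by simp
      finally have "C * qnorm E ((g + h) - J (a + b)) \<le> C * (e + e)"
        using C by (rule mult_left_mono)
      then show ?thesis using Th[OF Ecl(2)[OF g h] Xcl(2)[OF a(1) b(1)]] by linarith
    qed
    also have "qnorm Y (Th g - T a) \<le> C * e"
      using Th[OF g a(1)] mult_left_mono[OF less_imp_le[OF a(2)] C] by linarith
    also have "qnorm Y (Th h - T b) \<le> C * e"
      using Th[OF h b(1)] mult_left_mono[OF less_imp_le[OF b(2)] C] by linarith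
    finally show "qnorm Y (Th (g + h) - (Th g + Th h)) \<le> 4 * C * e" by (simp add: algebra_simps)
  qed
  interpret VE: vector_space "scal E" using E1 by (simp add: quasi_normed_def)
  interpret VY: vector_space "scal Y" using Y1 by (simp add: quasi_normed_def)
  have scE: "qnorm E (scal E c g) = norm c * qnorm E g" if "g \<in> carr E" for c g
    by (rule quasi_normedD(3)[OF E1 that])
  have scY: "qnorm Y (scal Y c g) = norm c * qnorm Y g" if "g \<in> carr Y" for c g
    by (rule quasi_normedD(3)[OF Y1 that])
  have scale: "Th (scal E c g) = scal Y c (Th g)" if g: "g \<in> carr E" for c g
  proof (rule eq_if_small[OF Y1 Thc[OF Ecl(4)[OF g]] Ycl(4)[OF Thc[OF g]],
        where K = "2 * (C * norm c)"])
    fix e :: real assume e: "0 < e"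
    obtain a where a: "a \<in> carr X" "qnorm E (g - J a) < e" using dense[OF g e] by blast
    let ?a = "scal X c a"
    have Ja: "J ?a = scal E c (J a)" and Ta: "T ?a = scal Y c (T a)"
      using Jl Tl a unfolding linear_betw_def by blast+
    have "qnorm Y (Th (scal E c g) - scal Y c (Th g))
        \<le> qnorm Y (Th (scal E c g) - T ?a) + qnorm Y (T ?a - scal Y c (Th g))"
      by (rule norm_dist_triangle[OF Y1]) (use Thc Tc Ecl Ycl Xcl g a in auto)
    also have "qnorm Y (T ?a - scal Y c (Th g)) = qnorm Y (scal Y c (Th g) - T ?a)"
      by (rule norm_dist_commute[OF Y1 _ _ Ycl(1)]) (use Thc Tc Ecl Ycl Xcl g a in auto)
    also have "\<dots> = norm c * qnorm Y (Th g - T a)"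
      using scY[OF Ycl(3)[OF Thc[OF g] Tc[OF a(1)]], of c] by (simp add: Ta VY.scale_right_diff_distrib)
    also have "\<dots> \<le> norm c * (C * e)"
      using Th[OF g a(1)] mult_left_mono[OF less_imp_le[OF a(2)] C] by (intro mult_left_mono) auto
    also have "qnorm Y (Th (scal E c g) - T ?a) \<le> C * (norm c * e)"
    proof -
      have "qnorm E (scal E c g - J ?a) = norm c * qnorm E (g - J a)"
        using scE[OF Ecl(3)[OF g Jc[OF a(1)]], of c] by (simp add: Ja VE.scale_right_diff_distrib)
      also have "\<dots> \<le> norm c * e" using a by (intro mult_left_mono) auto
      finally have "C * qnorm E (scal E c g - J ?a) \<le> C * (norm c * e)"
        using C by (rule mult_left_mono)
      then show ?thesis using Th[OF Ecl(4)[OF g] Xcl(4)[OF a(1)], of c c] by linarith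
    qed
    finally show "qnorm Y (Th (scal E c g) - scal Y c (Th g)) \<le> 2 * (C * norm c) * e"
      by (simp add: algebra_simps)
  qed
  have lin: "linear_betw E Y Th" unfolding linear_betw_def using Thc add scale by auto
  have cl: "cont_linear E Y Th" unfolding cont_linear_def using lin Thb by blast
  have opn: "op_norm E Y Th \<le> op_norm X Y T"
    unfolding op_norm_def[of E] C_def[symmetric]
  proof (rule cSUP_least)
    show "{f \<in> carr E. qnorm E f \<le> 1} \<noteq> {}" using Ecl(1) e0 by force
    fix g assume g: "g \<in> {f \<in> carr E. qnorm E f \<le> 1}"
    then have "C * qnorm E g \<le> C * 1" using C by (intro mult_left_mono) auto
    then show "qnorm Y (Th g) \<le> C" using Thb[of g] g by simp
  qed
  have uniq: "S g = Th g"
    if S: "cont_linear E Y S" and SJ: "\<forall>f\<in>carr X. S (J f) = T f" and g: "g \<in> carr E" for S g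
  proof -
    have Sl: "linear_betw E Y S" using S by (simp add: cont_linear_def)
    have Sc: "S h \<in> carr Y" if "h \<in> carr E" for h using Sl that unfolding linear_betw_def by blast
    obtain D where D: "\<And>h. h \<in> carr E \<Longrightarrow> qnorm Y (S h) \<le> D * qnorm E h"
      using S unfolding cont_linear_def by blast
    show ?thesis
    proof (rule eq_if_small[OF Y1 Sc[OF g] Thc[OF g], where K = "\<bar>D\<bar> + C"])
      fix e :: real assume e: "0 < e"
      obtain a where a: "a \<in> carr X" "qnorm E (g - J a) < e" using dense[OF g e] by blast
      have d: "g - J a \<in> carr E" using Ecl(3)[OF g Jc[OF a(1)]] .
      have "qnorm Y (S g - Th g) \<le> qnorm Y (S g - T a) + qnorm Y (T a - Th g)"
        by (rule norm_dist_triangle[OF Y1]) (use Sc Thc Tc g a in auto)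
      also have "qnorm Y (T a - Th g) = qnorm Y (Th g - T a)"
        by (rule norm_dist_commute[OF Y1 _ _ Ycl(1)]) (use Thc Tc g a in auto)
      also have "\<dots> \<le> C * e"
        using Th[OF g a(1)] mult_left_mono[OF less_imp_le[OF a(2)] C] by linarith
      also have "qnorm Y (S g - T a) \<le> \<bar>D\<bar> * e"
      proof -
        have "S g - T a = S (g - J a)"
          using linear_betw_diff[OF E1 Sl g Jc[OF a(1)]] SJ a(1) by simp
        then have "qnorm Y (S g - T a) \<le> D * qnorm E (g - J a)" using D[OF d] by simp
        also have "\<dots> \<le> \<bar>D\<bar> * e" using a Enn[OF d] by (intro mult_mono) auto
        finally show ?thesis .
      qed
      finally show "qnorm Y (S g - Th g) \<le> (\<bar>D\<bar> + C) * e" by (simp add: algebra_simps)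
    qed
  qed
  show ?thesis using cl ext opn uniq by blast
qed

end

theory Submission
  imports Defs
begin

text \<open>
  The quasi-norm is the maximum of two quantities: the weak \<open>\<ell>\<^sub>1\<close> quasi-norm, the supremum over
  \<open>t > 0\<close> of \<open>t\<close> times the number of \<open>n\<close> with \<open>t \<le> norm (f n)\<close>, and the supremum over \<open>t\<close>
  and \<open>M\<close> of the modulus of the partial sum of the \<open>f n\<close> with \<open>n < M\<close> and \<open>t \<le> norm (f n)\<close>. The
  space is the closure of the finitely supported scalar sequences, and the basis consists of the
  unit vectors.

  The thresholded sums are not linear in \<open>f\<close>, but almost: replacing the sum for \<open>f + g\<close> by those
  for \<open>f\<close> and \<open>g\<close> changes only terms at indices where one of \<open>f\<close>, \<open>g\<close>, \<open>f + g\<close> has modulus at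
  least \<open>t\<close>, and each such term by a few times \<open>t\<close>. Sequences in weak \<open>\<ell>\<^sub>1\<close> have \<open>O(1 / t)\<close> such
  indices, so the total error is bounded whatever \<open>t\<close> is. For finitely many summands the same
  argument, fed with truncated moments of order \<open>1 / p\<close>, gives local \<open>p\<close>-convexity for every
  \<open>p < 1\<close> (\<open>level_norm_sum_le\<close>).

  Greedy sets are level sets up to ties, so projections onto them are bounded by the very choice
  of the quasi-norm (\<open>level_norm_restr_greedy\<close>). A sum of unit vectors over \<open>A\<close> has quasi-norm
  \<open>card A\<close>, so the basis is democratic, and both properties together make it almost greedy.

  In the Banach envelope the two parts of the quasi-norm behave differently. The partial sums are
  functionals of norm one, so a sum of unit vectors over \<open>A\<close> keeps its full norm \<open>card A\<close>
  (\<open>indicator_norms\<close>). The weak \<open>\<ell>\<^sub>1\<close> part, however, loses a logarithm under averaging: the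
  alternating signs of length \<open>2 * L\<close>, multiplied by \<open>harm L\<close>, are the sum of the \<open>L\<close> cyclic shifts
  of the pairs \<open>1, - 1, 1 / 2, - 1 / 2, \<dots>, 1 / L, - 1 / L\<close>. The members of a pair cancel in the
  thresholded sums, so each shift has quasi-norm at most two, and the alternating signs have
  envelope norm at most \<open>2 * L / harm L\<close> (\<open>env_norm_alternating_le\<close>). Keeping only their positive
  terms raises the norm to \<open>L\<close>.
\<close>

section \<open>Sequence spaces given by monotone seminorms\<close>

definition restr :: "'i set \<Rightarrow> ('i \<Rightarrow> 'f::zero) \<Rightarrow> 'i \<Rightarrow> 'f" where
  "restr A f = (\<lambda>n. if n \<in> A then f n else 0)"

abbreviation head :: "nat \<Rightarrow> (nat \<Rightarrow> 'f::zero) \<Rightarrow> nat \<Rightarrow> 'f" where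
  "head N \<equiv> restr {..<N}"

definition seq_scale :: "'f::times \<Rightarrow> ('i \<Rightarrow> 'f) \<Rightarrow> 'i \<Rightarrow> 'f" where
  "seq_scale c f = (\<lambda>n. c * f n)"

definition unit_seq :: "'i \<Rightarrow> 'i \<Rightarrow> 'f::zero_neq_one" where
  "unit_seq n = (\<lambda>k. if k = n then 1 else 0)"

lemma restr_apply: "restr A f n = (if n \<in> A then f n else 0)"
  by (simp add: restr_def)

lemma seq_scale_apply [simp]: "seq_scale c f n = c * f n"
  by (simp add: seq_scale_def)

lemma sum_seq_apply: "(\<Sum>i\<in>A. F i) n = (\<Sum>i\<in>A. (F i n :: 'f::comm_monoid_add))"
  by (induction A rule: infinite_finite_induct) auto

lemma restr_add: "restr A (f + g) = restr A f + restr A (g :: 'i \<Rightarrow> 'f::monoid_add)"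
  by (auto simp: restr_def)

lemma restr_diff: "restr A (f - g) = restr A f - restr A (g :: 'i \<Rightarrow> 'f::group_add)"
  by (auto simp: restr_def)

lemma restr_seq_scale: "restr A (seq_scale c f) = seq_scale c (restr A (f :: 'i \<Rightarrow> 'f::mult_zero))"
  by (auto simp: restr_def)

lemma restr_restr: "restr A (restr B f) = restr (A \<inter> B) f"
  by (auto simp: restr_def)

lemma restr_Compl: "restr (- A) f = f - restr A (f :: 'i \<Rightarrow> 'f::group_add)"
  by (auto simp: restr_def)

lemma sum_scale_unit_seq:
  fixes a :: "'i \<Rightarrow> 'f::semiring_1"
  assumes "finite A"
  shows "(\<Sum>n\<in>A. seq_scale (a n) (unit_seq n)) = restr A a"
proof
  fix k
  have "(\<Sum>n\<in>A. a n * unit_seq n k) = (\<Sum>n\<in>A. if n = k then a n else 0)"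
    by (rule sum.cong) (auto simp: unit_seq_def)
  then show "(\<Sum>n\<in>A. seq_scale (a n) (unit_seq n)) k = restr A a k"
    using assms by (simp add: sum_seq_apply restr_def)
qed

lemma vector_space_seq_scale: "vector_space (seq_scale :: 'f::field \<Rightarrow> ('i \<Rightarrow> 'f) \<Rightarrow> _)"
  by unfold_locales (auto simp: fun_eq_iff algebra_simps)

text \<open>
  A family of seminorms \<open>r N\<close>, where \<open>r N\<close> sees only the first \<open>N\<close> coordinates, produces the
  completion of the finitely supported sequences in the supremum of the family. Elements of that
  completion are still sequences, namely those whose tails \<open>f - head N f\<close> tend to zero
  uniformly in all the seminorms. The same construction yields both the space of the example and
  its Banach envelope.
\<close>

definition seq_space :: "(nat \<Rightarrow> (nat \<Rightarrow> 'f) \<Rightarrow> real) \<Rightarrow> 'f::real_normed_field seq_qspace" where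
  "seq_space r = \<lparr>scal = seq_scale, carr = {f. \<forall>e>0. \<exists>N. \<forall>M. r M (f - head N f) \<le> e},
     qnorm = (\<lambda>f. SUP N. r N f)\<rparr>"

locale monotone_seminorms =
  fixes r :: "nat \<Rightarrow> (nat \<Rightarrow> 'f::{real_normed_field, banach}) \<Rightarrow> real" and \<kappa> :: real
  assumes kappa: "1 \<le> \<kappa>"
    and r_add: "r N (f + g) \<le> \<kappa> * (r N f + r N g)"
    and r_scale: "r N (seq_scale c f) = norm c * r N f"
    and r_head: "r M (head N f) = r (min M N) f"
    and r_mono: "N \<le> M \<Longrightarrow> r N f \<le> r M f"
    and r_coord: "n < N \<Longrightarrow> norm (f n) \<le> r N f"
    and r_sum: "r N f \<le> (\<Sum>n<N. norm (f n))"
begin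

abbreviation "X \<equiv> seq_space r"

lemma scal_X [simp]: "scal X = seq_scale"
  by (simp add: seq_space_def)

lemma qnorm_X: "qnorm X f = (SUP N. r N f)"
  by (simp add: seq_space_def)

lemma r_minus: "r N (- f) = r N f"
proof -
  have "- f = seq_scale (- 1) f" by auto
  then show ?thesis by (simp only: r_scale) simp
qed

lemma r_zero: "r N 0 = 0"
proof -
  have "0 = seq_scale 0 (0 :: nat \<Rightarrow> 'f)" by auto
  then show ?thesis using r_scale[of N 0 0] by simp
qed

lemma r_diff: "r N (f - g) \<le> \<kappa> * (r N f + r N g)"
  using r_add[of N f "- g"] by (simp add: r_minus)

lemma r_nonneg: "0 \<le> r N f"
proof -
  have "0 \<le> \<kappa> * (r N f + r N f)" using r_diff[of N f f] by (simp add: r_zero)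
  then show ?thesis using kappa by (simp add: zero_le_mult_iff)
qed

lemma r_swap: "r N (f - g) = r N (g - f)"
  using r_minus[of N "f - g"] by simp

lemma r_head_le: "r M (head N f) \<le> r M f"
  by (simp add: r_head r_mono)

lemma r_tail_le: "r M (f - head N f) \<le> 2 * \<kappa> * r M f"
proof -
  have "r M (f - head N f) \<le> \<kappa> * (r M f + r M (head N f))" by (rule r_diff)
  also have "\<dots> \<le> \<kappa> * (r M f + r M f)" using kappa r_head_le[of M N f] by (intro mult_left_mono) auto
  finally show ?thesis by simp
qed

lemma carrI: "(\<And>e. 0 < e \<Longrightarrow> \<exists>N. \<forall>M. r M (f - head N f) \<le> e) \<Longrightarrow> f \<in> carr X"
  by (simp add: seq_space_def)

lemma carr_tail:
  assumes "f \<in> carr X" "0 < e"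
  obtains N0 where "\<And>N M. N0 \<le> N \<Longrightarrow> r M (f - head N f) \<le> e"
proof -
  have "0 < e / (2 * \<kappa>)" using assms kappa by simp
  then obtain N0 where N0: "\<And>M. r M (f - head N0 f) \<le> e / (2 * \<kappa>)"
    using assms(1) unfolding seq_space_def by auto
  have "r M (f - head N f) \<le> e" if "N0 \<le> N" for N M
  proof -
    have "f - head N f = (f - head N0 f) - head N (f - head N0 f)"
      using that by (auto simp: restr_apply fun_eq_iff)
    then have "r M (f - head N f) \<le> 2 * \<kappa> * r M (f - head N0 f)" using r_tail_le by metis
    also have "\<dots> \<le> 2 * \<kappa> * (e / (2 * \<kappa>))" using N0 kappa by (intro mult_left_mono) auto
    also have "\<dots> = e" using kappa by simp
    finally show ?thesis .
  qed
  then show ?thesis using that by blast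
qed

lemma head_carr: "head N f \<in> carr X"
proof (rule carrI)
  fix e :: real assume "0 < e"
  have "head N f - head N (head N f) = 0" by (simp add: restr_restr)
  then show "\<exists>K. \<forall>M. r M (head N f - head K (head N f)) \<le> e"
    using \<open>0 < e\<close> r_zero by (intro exI[of _ N]) simp
qed

lemma carr_add:
  assumes "f \<in> carr X" "g \<in> carr X"
  shows "f + g \<in> carr X"
proof (rule carrI)
  fix e :: real assume "0 < e"
  then have e: "0 < e / (2 * \<kappa>)" using kappa by simp
  obtain A where A: "\<And>N M. A \<le> N \<Longrightarrow> r M (f - head N f) \<le> e / (2 * \<kappa>)"
    using carr_tail[OF assms(1) e] by blast
  obtain B where B: "\<And>N M. B \<le> N \<Longrightarrow> r M (g - head N g) \<le> e / (2 * \<kappa>)"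
    using carr_tail[OF assms(2) e] by blast
  define N where "N = max A B"
  have "r M (f + g - head N (f + g)) \<le> e" for M
  proof -
    have "f + g - head N (f + g) = (f - head N f) + (g - head N g)" by (simp add: restr_add)
    then have "r M (f + g - head N (f + g)) \<le> \<kappa> * (r M (f - head N f) + r M (g - head N g))"
      using r_add by metis
    also have "\<dots> \<le> \<kappa> * (e / (2 * \<kappa>) + e / (2 * \<kappa>))"
      using A[of N M] B[of N M] kappa by (intro mult_left_mono add_mono) (auto simp: N_def)
    also have "\<dots> = e" using kappa by (simp add: field_simps)
    finally show ?thesis .
  qed
  then show "\<exists>N. \<forall>M. r M (f + g - head N (f + g)) \<le> e" by blast
qed

lemma carr_scale:
  assumes "f \<in> carr X"
  shows "seq_scale c f \<in> carr X"
proof (rule carrI)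
  fix e :: real assume "0 < e"
  then have e: "0 < e / (norm c + 1)" by (simp add: add_nonneg_pos)
  obtain A where A: "\<And>N M. A \<le> N \<Longrightarrow> r M (f - head N f) \<le> e / (norm c + 1)"
    using carr_tail[OF assms e] by blast
  have "r M (seq_scale c f - head A (seq_scale c f)) \<le> e" for M
  proof -
    have "seq_scale c f - head A (seq_scale c f) = seq_scale c (f - head A f)"
      by (auto simp: restr_apply fun_eq_iff)
    then have "r M (seq_scale c f - head A (seq_scale c f)) = norm c * r M (f - head A f)"
      by (simp only: r_scale)
    also have "\<dots> \<le> (norm c + 1) * (e / (norm c + 1))"
      using A[of A M] r_nonneg[of M] by (intro mult_mono) auto
    also have "\<dots> = e" by (simp add: add_nonneg_eq_0_iff)
    finally show ?thesis .
  qed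
  then show "\<exists>N. \<forall>M. r M (seq_scale c f - head N (seq_scale c f)) \<le> e" by blast
qed

lemma carr_diff: "f \<in> carr X \<Longrightarrow> g \<in> carr X \<Longrightarrow> f - g \<in> carr X"
proof -
  assume "f \<in> carr X" "g \<in> carr X"
  then have "f + seq_scale (- 1) g \<in> carr X" by (intro carr_add carr_scale)
  moreover have "f + seq_scale (- 1) g = f - g" by auto
  ultimately show ?thesis by simp
qed

lemma carr_zero: "0 \<in> carr X"
proof -
  have "head 0 (0 :: nat \<Rightarrow> 'f) = 0" by (auto simp: restr_apply)
  then show ?thesis using head_carr[of 0 0] by simp
qed

lemma r_le_qnorm:
  assumes "f \<in> carr X"
  shows "r N f \<le> qnorm X f"
proof -
  obtain A where A: "\<And>N M. A \<le> N \<Longrightarrow> r M (f - head N f) \<le> 1"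
    using carr_tail[OF assms, of 1] by auto
  have "r M f \<le> \<kappa> * (1 + r A f)" for M
  proof -
    have "r M f \<le> \<kappa> * (r M (f - head A f) + r M (head A f))"
      using r_add[of M "f - head A f" "head A f"] by simp
    also have "\<dots> \<le> \<kappa> * (1 + r A f)"
      using A[of A M] kappa r_mono[of "min M A" A f]
      by (intro mult_left_mono add_mono) (auto simp: r_head)
    finally show ?thesis .
  qed
  then have "bdd_above (range (\<lambda>N. r N f))" by (intro bdd_aboveI2)
  then show ?thesis unfolding qnorm_X by (intro cSUP_upper) auto
qed

lemma qnorm_le: "(\<And>N. r N f \<le> C) \<Longrightarrow> qnorm X f \<le> C"
  unfolding qnorm_X by (rule cSUP_least) auto

lemma qnorm_nonneg: "f \<in> carr X \<Longrightarrow> 0 \<le> qnorm X f"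
  using r_le_qnorm[of f 0] r_nonneg[of 0 f] by linarith

lemma coord_le_qnorm: "f \<in> carr X \<Longrightarrow> norm (f n) \<le> qnorm X f"
  using r_le_qnorm[of f "Suc n"] r_coord[of n "Suc n" f] by linarith

lemma qnorm_zero: "qnorm X 0 = 0"
  using qnorm_le[of 0 0] qnorm_nonneg[OF carr_zero] r_zero by force

lemma qnorm_scale_le:
  assumes "f \<in> carr X"
  shows "qnorm X (seq_scale c f) \<le> norm c * qnorm X f"
  by (rule qnorm_le) (auto simp: r_scale intro!: mult_left_mono r_le_qnorm assms)

lemma qnorm_scale:
  assumes "f \<in> carr X"
  shows "qnorm X (seq_scale c f) = norm c * qnorm X f"
proof (cases "c = 0")
  case True
  then have "seq_scale c f = 0" by auto
  then show ?thesis using True qnorm_zero by simp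
next
  case False
  have "f = seq_scale (inverse c) (seq_scale c f)" using False by auto
  then have "qnorm X f \<le> norm (inverse c) * qnorm X (seq_scale c f)"
    using qnorm_scale_le[OF carr_scale[OF assms, of c], of "inverse c"] by simp
  then have "norm c * qnorm X f \<le> qnorm X (seq_scale c f)"
    using False by (simp add: norm_divide field_simps)
  then show ?thesis using qnorm_scale_le[OF assms, of c] by linarith
qed

lemma qnorm_add:
  assumes "f \<in> carr X" "g \<in> carr X"
  shows "qnorm X (f + g) \<le> \<kappa> * (qnorm X f + qnorm X g)"
proof (rule qnorm_le)
  fix N
  have "r N (f + g) \<le> \<kappa> * (r N f + r N g)" by (rule r_add)
  also have "\<dots> \<le> \<kappa> * (qnorm X f + qnorm X g)"
    using kappa r_le_qnorm assms by (intro mult_left_mono add_mono) auto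
  finally show "r N (f + g) \<le> \<kappa> * (qnorm X f + qnorm X g)" .
qed

lemma quasi_normed_seq_space: "quasi_normed X \<kappa>"
proof -
  interpret V: vector_space "seq_scale :: 'f \<Rightarrow> (nat \<Rightarrow> 'f) \<Rightarrow> _" by (rule vector_space_seq_scale)
  have "f = 0" if "f \<in> carr X" "qnorm X f = 0" for f
    using coord_le_qnorm[OF that(1)] that(2) by (auto simp: fun_eq_iff)
  then show ?thesis
    unfolding quasi_normed_def
    by (auto simp: vector_space_seq_scale V.subspace_def carr_zero carr_add carr_scale
        qnorm_nonneg qnorm_zero qnorm_scale qnorm_add)
qed

text \<open>
  A quasi-norm need not be continuous, so the limit is taken in the second of the two terms
  \<open>r N (u m - u k)\<close> and \<open>r N (u k - f)\<close> only: it involves \<open>N\<close> coordinates and is controlled by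
  \<open>r_sum\<close>. The price is one factor \<open>\<kappa>\<close>.
\<close>

lemma pointwise_limit:
  assumes u: "\<And>m. u m \<in> carr X" and f: "\<And>n. (\<lambda>m. u m n) \<longlonglongrightarrow> f n"
    and cauchy: "\<And>k. k \<ge> M \<Longrightarrow> qnorm X (u m - u k) \<le> e"
  shows "r N (u m - f) \<le> \<kappa> * e"
proof (rule LIMSEQ_le_const)
  have "(\<lambda>k. \<kappa> * (e + (\<Sum>n<N. norm (u k n - f n)))) \<longlonglongrightarrow> \<kappa> * (e + (\<Sum>n<N. norm (f n - f n)))"
    by (intro tendsto_intros f)
  then show "(\<lambda>k. \<kappa> * (e + (\<Sum>n<N. norm (u k n - f n)))) \<longlonglongrightarrow> \<kappa> * e" by simp
  have "r N (u m - f) \<le> \<kappa> * (e + (\<Sum>n<N. norm (u k n - f n)))" if "k \<ge> M" for k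
  proof -
    have "r N (u m - f) \<le> \<kappa> * (r N (u m - u k) + r N (u k - f))"
      using r_add[of N "u m - u k" "u k - f"] by simp
    also have "\<dots> \<le> \<kappa> * (e + (\<Sum>n<N. norm ((u k - f) n)))"
      using kappa r_le_qnorm[OF carr_diff[OF u u], of N m k] cauchy[OF that] r_sum[of N "u k - f"]
      by (intro mult_left_mono add_mono) auto
    finally show ?thesis by simp
  qed
  then show "\<exists>K. \<forall>k\<ge>K. r N (u m - f) \<le> \<kappa> * (e + (\<Sum>n<N. norm (u k n - f n)))" by blast
qed

lemma complete_seq_space: "complete_space_on X"
  unfolding complete_space_on_def
proof (intro allI impI)
  fix u :: "nat \<Rightarrow> nat \<Rightarrow> 'f"
  assume *: "range u \<subseteq> carr X \<and> (\<forall>e>0. \<exists>M. \<forall>m\<ge>M. \<forall>n\<ge>M. qnorm X (u m - u n) < e)"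
  then have u: "\<And>m. u m \<in> carr X" by auto
  have cauchy: "\<exists>M. \<forall>m\<ge>M. \<forall>k\<ge>M. qnorm X (u m - u k) < e" if "e > 0" for e using * that by blast
  have "\<exists>l. (\<lambda>m. u m n) \<longlonglongrightarrow> l" for n
  proof -
    have "Cauchy (\<lambda>m. u m n)"
    proof (rule CauchyI)
      fix e :: real assume "0 < e"
      then obtain M where M: "\<forall>m\<ge>M. \<forall>k\<ge>M. qnorm X (u m - u k) < e" using cauchy by blast
      have "norm (u m n - u k n) < e" if "M \<le> m" "M \<le> k" for m k
        using coord_le_qnorm[OF carr_diff[OF u u], of m k n] M that by fastforce
      then show "\<exists>M. \<forall>m\<ge>M. \<forall>k\<ge>M. norm (u m n - u k n) < e" by blast
    qed
    then show ?thesis by (simp add: Cauchy_convergent_iff convergent_def)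
  qed
  then obtain f where f: "\<And>n. (\<lambda>m. u m n) \<longlonglongrightarrow> f n" by metis
  have close: "\<exists>M. \<forall>m\<ge>M. \<forall>N. r N (u m - f) \<le> \<kappa> * e" if e: "e > 0" for e
  proof -
    obtain M where M: "\<forall>m\<ge>M. \<forall>k\<ge>M. qnorm X (u m - u k) < e" using cauchy[OF e] by blast
    then show ?thesis using pointwise_limit[OF u f] by (meson less_imp_le)
  qed
  have fX: "f \<in> carr X"
  proof (rule carrI)
    fix e :: real assume "0 < e"
    \<comment> \<open>The denominator collects the factors from splitting \<open>f\<close> into \<open>u m\<close> and \<open>f - u m\<close> and from
      passing to the tail of \<open>u m - f\<close>.\<close>
    define d where "d = e / (\<kappa> * (1 + 2 * \<kappa> * \<kappa>))"
    have k0: "0 < \<kappa> * (1 + 2 * \<kappa> * \<kappa>)" using kappa by (simp add: add_pos_pos)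
    then have d: "0 < d" using \<open>0 < e\<close> by (simp add: d_def)
    obtain m where m: "\<And>N. r N (u m - f) \<le> \<kappa> * d" using close[OF d] by blast
    obtain N where N: "\<And>K M. N \<le> K \<Longrightarrow> r M (u m - head K (u m)) \<le> d"
      using carr_tail[OF u d] by blast
    have "r M (f - head N f) \<le> e" for M
    proof -
      have "f - head N f = (u m - head N (u m)) - ((u m - f) - head N (u m - f))"
        by (simp add: restr_diff)
      then have "r M (f - head N f)
          \<le> \<kappa> * (r M (u m - head N (u m)) + r M ((u m - f) - head N (u m - f)))"
        using r_diff by metis
      also have "\<dots> \<le> \<kappa> * (d + 2 * \<kappa> * (\<kappa> * d))"
        using kappa N[of N M]
        by (intro mult_left_mono add_mono order_trans[OF r_tail_le[of M "u m - f"]] m) auto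
      also have "\<dots> = (\<kappa> * (1 + 2 * \<kappa> * \<kappa>)) * d" by (simp add: algebra_simps)
      also have "\<dots> = e"
        unfolding d_def times_divide_eq_right using k0
        by (intro nonzero_mult_div_cancel_left less_imp_neq[symmetric])
      finally show ?thesis .
    qed
    then show "\<exists>N. \<forall>M. r M (f - head N f) \<le> e" by blast
  qed
  have "(\<lambda>m. qnorm X (u m - f)) \<longlonglongrightarrow> 0"
  proof (rule LIMSEQ_I)
    fix e :: real assume e: "0 < e"
    then have "0 < e / (2 * \<kappa>)" using kappa by simp
    then obtain M where M: "\<And>m N. M \<le> m \<Longrightarrow> r N (u m - f) \<le> \<kappa> * (e / (2 * \<kappa>))"
      using close by blast
    have "norm (qnorm X (u m - f) - 0) < e" if "M \<le> m" for m
    proof -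
      have "qnorm X (u m - f) \<le> \<kappa> * (e / (2 * \<kappa>))" using M[OF that] by (rule qnorm_le)
      also have "\<dots> < e" using kappa e by simp
      finally show ?thesis using qnorm_nonneg[OF carr_diff[OF u fX]] by simp
    qed
    then show "\<exists>M. \<forall>m\<ge>M. norm (qnorm X (u m - f) - 0) < e" by blast
  qed
  then show "\<exists>f\<in>carr X. converges_in X u f" using fX unfolding converges_in_def by blast
qed

lemma unit_seq_carr: "unit_seq n \<in> carr X"
proof -
  have "unit_seq n = head (Suc n) (unit_seq n :: nat \<Rightarrow> 'f)"
    by (auto simp: unit_seq_def restr_apply fun_eq_iff)
  then show ?thesis using head_carr by metis
qed

lemma restr_carr: "finite A \<Longrightarrow> restr A f \<in> carr X"
proof -
  assume "finite A"
  then obtain N where "A \<subseteq> {..<N}" by (meson finite_nat_iff_bounded)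
  then have "restr A f = head N (restr A f)" by (auto simp: restr_apply fun_eq_iff)
  then show ?thesis using head_carr by metis
qed

lemma qnorm_restr_le:
  assumes "finite A"
  shows "qnorm X (restr A f) \<le> (\<Sum>n\<in>A. norm (f n))"
proof (rule qnorm_le)
  fix N
  have "r N (restr A f) \<le> (\<Sum>n<N. norm (restr A f n))" by (rule r_sum)
  also have "\<dots> = (\<Sum>n\<in>{..<N} \<inter> A. norm (f n))" by (auto simp: restr_apply sum.If_cases if_distrib)
  also have "\<dots> \<le> (\<Sum>n\<in>A. norm (f n))" using assms by (intro sum_mono2) auto
  finally show "r N (restr A f) \<le> (\<Sum>n\<in>A. norm (f n))" .
qed

lemma qnorm_unit_seq: "qnorm X (unit_seq n) = 1"
proof (rule antisym)
  have "unit_seq n = restr {n} (unit_seq n :: nat \<Rightarrow> 'f)"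
    by (auto simp: unit_seq_def restr_apply fun_eq_iff)
  then show "qnorm X (unit_seq n) \<le> 1" 
    using qnorm_restr_le[of "{n}" "unit_seq n"] by (simp add: unit_seq_def)
  show "1 \<le> qnorm X (unit_seq n)"
    using coord_le_qnorm[OF unit_seq_carr, of n n] by (simp add: unit_seq_def)
qed

lemma head_converges:
  assumes "f \<in> carr X"
  shows "(\<lambda>N. qnorm X (head N f - f)) \<longlonglongrightarrow> 0"
proof (rule LIMSEQ_I)
  fix e :: real assume e: "0 < e"
  then have "0 < e / 2" by simp
  then obtain A where A: "\<And>N M. A \<le> N \<Longrightarrow> r M (f - head N f) \<le> e / 2"
    using carr_tail[OF assms] by blast
  have "norm (qnorm X (head N f - f) - 0) < e" if "A \<le> N" for N
  proof -
    have "qnorm X (head N f - f) \<le> e / 2"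
      using A[OF that] r_swap by (intro qnorm_le) metis
    then show ?thesis using e qnorm_nonneg[OF carr_diff[OF head_carr assms]] by simp
  qed
  then show "\<exists>A. \<forall>N\<ge>A. norm (qnorm X (head N f - f) - 0) < e" by blast
qed

lemma schauder_basis_unit_seq: "schauder_basis X unit_seq"
  unfolding schauder_basis_def
proof (intro conjI ballI)
  show "range unit_seq \<subseteq> carr X" using unit_seq_carr by auto
  fix f assume f: "f \<in> carr X"
  have partial: "(\<Sum>n<N. scal X (a n) (unit_seq n)) = head N a" for N a
    by (simp add: sum_scale_unit_seq)
  show "\<exists>!a. converges_in X (\<lambda>N. \<Sum>n<N. scal X (a n) (unit_seq n)) f"
    unfolding partial converges_in_def
  proof (rule ex1I)
    show "(\<lambda>N. qnorm X (head N f - f)) \<longlonglongrightarrow> 0" by (rule head_converges[OF f])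
    fix a assume a: "(\<lambda>N. qnorm X (head N a - f)) \<longlonglongrightarrow> 0"
    show "a = f"
    proof
      fix n
      have "(\<lambda>N. norm (a n - f n)) \<longlonglongrightarrow> 0"
      proof (rule tendsto_sandwich[OF _ _ tendsto_const a])
        show "\<forall>\<^sub>F N in sequentially. norm (a n - f n) \<le> qnorm X (head N a - f)"
          using eventually_gt_at_top[of n]
        proof eventually_elim
          case (elim N)
          then show ?case
            using coord_le_qnorm[OF carr_diff[OF head_carr f], of N a n] by (simp add: restr_apply)
        qed
      qed simp
      then have "norm (a n - f n) = 0" by (simp add: LIMSEQ_const_iff)
      then show "a n = f n" by simp
    qed
  qed
qed

lemma coord_cont_linear: "cont_linear X scalars (\<lambda>f. f n)"
  unfolding cont_linear_def linear_betw_def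
  using coord_le_qnorm[of _ n] by (auto simp: scalars_def intro!: exI[of _ 1])

lemma W_basis_unit_seq: "W_basis X unit_seq (\<lambda>n f. f n)"
  unfolding W_basis_def
proof (intro conjI)
  show "minimal_system X unit_seq (\<lambda>n f. f n)"
    unfolding minimal_system_def using unit_seq_carr coord_cont_linear
    by (auto simp: unit_seq_def)
  interpret V: vector_space "seq_scale :: 'f \<Rightarrow> (nat \<Rightarrow> 'f) \<Rightarrow> _" by (rule vector_space_seq_scale)
  show "complete_system X unit_seq" unfolding complete_system_def
  proof (intro ballI allI impI)
    fix f and e :: real assume f: "f \<in> carr X" and e: "0 < e"
    obtain N where "norm (qnorm X (head N f - f) - 0) < e"
      using LIMSEQ_D[OF head_converges[OF f] e] by blast
    moreover have "qnorm X (head N f - f) = qnorm X (f - head N f)"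
      by (simp add: qnorm_X r_swap)
    ultimately have "qnorm X (f - head N f) < e" by simp
    moreover have "head N f \<in> V.span (range unit_seq)"
      unfolding sum_scale_unit_seq[OF finite_lessThan, symmetric]
      by (intro V.span_sum V.span_scale V.span_base) auto
    ultimately show "\<exists>g\<in>module.span (scal X) (range unit_seq). qnorm X (f - g) < e" by auto
  qed
  show "semi_normalized X unit_seq" unfolding semi_normalized_def by (simp add: qnorm_unit_seq)
  have "op_norm X scalars (\<lambda>f. f n) \<le> 1" for n
    unfolding op_norm_def
  proof (rule cSUP_least)
    show "{f \<in> carr X. qnorm X f \<le> 1} \<noteq> {}" using carr_zero qnorm_zero by force
    show "qnorm scalars (f n) \<le> 1" if "f \<in> {f \<in> carr X. qnorm X f \<le> 1}" for f
      using that coord_le_qnorm[of f n] by (simp add: scalars_def)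
  qed
  then show "M_bounded X unit_seq (\<lambda>n f. f n)"
    unfolding M_bounded_def by (intro bdd_aboveI2[of _ _ 1]) (simp add: qnorm_unit_seq)
qed

end

section \<open>The seminorm of the Banach envelope\<close>

text \<open>
  The Minkowski functional of the convex hull of the unit ball is a seminorm because the hull is
  convex (triangle inequality) and stable under scalars of modulus one (homogeneity).
\<close>

lemma hull_convex_in: "convex_in X (convex_in X hull S)"
  by (rule hull_in) (auto simp: convex_in_def)

lemma convex_in_hullD:
  assumes "f \<in> convex_in X hull S" "g \<in> convex_in X hull S" "0 \<le> a" "0 \<le> b" "a + b = 1"
  shows "scal X (of_real a) f + scal X (of_real b) g \<in> convex_in X hull S"
  using hull_convex_in[of X S, unfolded convex_in_def[of X "convex_in X hull S"]] assms by blast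

lemma env_norm_leI:
  assumes "0 < t" "scal X (of_real (inverse t)) f \<in> convex_in X hull {g \<in> carr X. qnorm X g \<le> 1}"
  shows "env_norm X f \<le> t"
  unfolding env_norm_def using assms by (intro cInf_lower) (auto intro!: bdd_belowI[of _ 0])

lemma env_norm_approx:
  fixes X :: "('f::real_normed_field, 'v::ab_group_add) qspace"
  assumes X: "quasi_normed X k" and f: "f \<in> carr X" and e: "0 < e"
  obtains t where "0 < t" "t < env_norm X f + e"
    "scal X (of_real (inverse t)) f \<in> convex_in X hull {g \<in> carr X. qnorm X g \<le> 1}"
proof -
  let ?S = "{t. 0 < t \<and> scal X (of_real (inverse t)) f \<in> convex_in X hull {g \<in> carr X. qnorm X g \<le> 1}}"
  have "qnorm X f + 1 \<in> ?S"
    using env_norm_set_nonempty[OF X f, of "qnorm X f + 1"] quasi_normedD(1)[OF X f] by simp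
  then have "?S \<noteq> {}" by (metis empty_iff)
  moreover have "Inf ?S < env_norm X f + e" using e by (simp add: env_norm_def)
  ultimately obtain t where t: "t \<in> ?S" "t < env_norm X f + e" by (meson cInf_lessD)
  show ?thesis by (rule that[of t]) (use t in auto)
qed

lemma env_norm_nonneg:
  fixes X :: "('f::real_normed_field, 'v::ab_group_add) qspace"
  assumes X: "quasi_normed X k" and f: "f \<in> carr X"
  shows "0 \<le> env_norm X f"
proof (rule field_le_epsilon)
  fix e :: real assume "0 < e"
  then obtain t where "0 < t" "t < env_norm X f + e" by (rule env_norm_approx[OF X f])
  then show "0 \<le> env_norm X f + e" by simp
qed

lemma env_norm_add:
  fixes X :: "('f::real_normed_field, 'v::ab_group_add) qspace"
  assumes X: "quasi_normed X k" and f: "f \<in> carr X" and g: "g \<in> carr X"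
  shows "env_norm X (f + g) \<le> env_norm X f + env_norm X g"
proof (rule field_le_epsilon)
  interpret V: vector_space "scal X" using X by (simp add: quasi_normed_def)
  let ?K = "convex_in X hull {g \<in> carr X. qnorm X g \<le> 1}"
  fix e :: real assume "0 < e"
  then have e: "0 < e / 2" by simp
  obtain s where s: "0 < s" "s < env_norm X f + e / 2" "scal X (of_real (inverse s)) f \<in> ?K"
    by (rule env_norm_approx[OF X f e])
  obtain t where t: "0 < t" "t < env_norm X g + e / 2" "scal X (of_real (inverse t)) g \<in> ?K"
    by (rule env_norm_approx[OF X g e])
  have comb: "scal X (of_real (s / (s + t))) (scal X (of_real (inverse s)) f)
      + scal X (of_real (t / (s + t))) (scal X (of_real (inverse t)) g) \<in> ?K"
  proof (rule convex_in_hullD[OF s(3) t(3)])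
    show "s / (s + t) + t / (s + t) = 1"
      unfolding add_divide_distrib[symmetric] using s(1) t(1) by simp
  qed (use s(1) t(1) in auto)
  have cf: "(of_real (s / (s + t)) * of_real (inverse s) :: 'f) = of_real (inverse (s + t))"
    unfolding of_real_mult[symmetric] using s(1) t(1) by (intro arg_cong[of _ _ of_real]) (simp add: field_simps)
  have cg: "(of_real (t / (s + t)) * of_real (inverse t) :: 'f) = of_real (inverse (s + t))"
    unfolding of_real_mult[symmetric] using s(1) t(1) by (intro arg_cong[of _ _ of_real]) (simp add: field_simps)
  have "scal X (of_real (inverse (s + t))) (f + g) \<in> ?K"
    using comb by (simp only: V.scale_scale cf cg V.scale_right_distrib)
  then have "env_norm X (f + g) \<le> s + t" using s t by (intro env_norm_leI) auto
  then show "env_norm X (f + g) \<le> env_norm X f + env_norm X g + e" using s t by linarith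
qed

lemma env_norm_scale_le:
  fixes X :: "('f::real_normed_field, 'v::ab_group_add) qspace"
  assumes X: "quasi_normed X k" and f: "f \<in> carr X" and c: "c \<noteq> 0"
  shows "env_norm X (scal X c f) \<le> norm c * env_norm X f"
proof -
  interpret V: vector_space "scal X" using X by (simp add: quasi_normed_def)
  let ?B = "{g \<in> carr X. qnorm X g \<le> 1}"
  let ?K = "convex_in X hull ?B"
  define d where "d = c / of_real (norm c)"
  have d: "norm d = 1" using c by (simp add: d_def norm_divide)
  \<comment> \<open>The hull inherits the invariance of the unit ball under scalars of modulus one.\<close>
  have "?K \<subseteq> {g. scal X d g \<in> ?K}"
  proof (rule hull_minimal)
    show "?B \<subseteq> {g. scal X d g \<in> ?K}"
      using subspace_closed(4)[OF X] quasi_normedD(3)[OF X] d by (auto intro!: hull_inc)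
    show "convex_in X {g. scal X d g \<in> ?K}"
      unfolding convex_in_def[of X "{g. scal X d g \<in> ?K}"]
    proof (intro ballI allI impI)
      fix g h and a b :: real
      assume g: "g \<in> {g. scal X d g \<in> ?K}" and h: "h \<in> {g. scal X d g \<in> ?K}"
        and ab: "0 \<le> a \<and> 0 \<le> b \<and> a + b = 1"
      have "scal X (of_real a) (scal X d g) + scal X (of_real b) (scal X d h) \<in> ?K"
        using g h ab by (intro convex_in_hullD) auto
      then show "scal X (of_real a) g + scal X (of_real b) h \<in> {g. scal X d g \<in> ?K}"
        by (simp add: V.scale_right_distrib mult.commute)
    qed
  qed
  then have inv: "scal X d g \<in> ?K" if "g \<in> ?K" for g using that by blast
  show ?thesis
  proof (rule field_le_epsilon)
    fix e :: real assume "0 < e"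
    then have e: "0 < e / norm c" using c by simp
    obtain t where t: "0 < t" "t < env_norm X f + e / norm c" "scal X (of_real (inverse t)) f \<in> ?K"
      by (rule env_norm_approx[OF X f e])
    have "(of_real (inverse (norm c * t)) * c :: 'f) = d * of_real (inverse t)"
      using t c by (simp add: d_def field_simps)
    then have "scal X (of_real (inverse (norm c * t))) (scal X c f)
        = scal X d (scal X (of_real (inverse t)) f)"
      by (simp only: V.scale_scale)
    then have "scal X (of_real (inverse (norm c * t))) (scal X c f) \<in> ?K"
      using inv[OF t(3)] by (simp only:)
    then have "env_norm X (scal X c f) \<le> norm c * t"
      using t(1) c by (intro env_norm_leI) simp
    also have "\<dots> \<le> norm c * (env_norm X f + e / norm c)" using t by (intro mult_left_mono) auto
    also have "\<dots> = norm c * env_norm X f + e" using c by (simp add: field_simps)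
    finally show "env_norm X (scal X c f) \<le> norm c * env_norm X f + e" .
  qed
qed

lemma env_norm_scale:
  fixes X :: "('f::real_normed_field, 'v::ab_group_add) qspace"
  assumes X: "quasi_normed X k" and f: "f \<in> carr X"
  shows "env_norm X (scal X c f) = norm c * env_norm X f"
proof (cases "c = 0")
  case True
  interpret V: vector_space "scal X" using X by (simp add: quasi_normed_def)
  have "0 \<in> carr X" by (rule subspace_closed(1)[OF X])
  then have "env_norm X 0 = 0"
    using env_norm_le[OF X, of 0] env_norm_nonneg[OF X, of 0] quasi_normedD(2)[OF X, of 0] by simp
  then show ?thesis using True by simp
next
  case False
  interpret V: vector_space "scal X" using X by (simp add: quasi_normed_def)
  have "scal X (inverse c) (scal X c f) = f" using False by simp
  then have "env_norm X f \<le> norm (inverse c) * env_norm X (scal X c f)"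
    using env_norm_scale_le[OF X subspace_closed(4)[OF X f, of c], of "inverse c"] False by simp
  then have "norm c * env_norm X f \<le> env_norm X (scal X c f)"
    using False by (simp add: norm_divide field_simps)
  then show ?thesis using env_norm_scale_le[OF X f False] by linarith
qed

lemma env_norm_sum:
  fixes X :: "('f::real_normed_field, 'v::ab_group_add) qspace"
  assumes X: "quasi_normed X k" and "\<And>i. i \<in> I \<Longrightarrow> F i \<in> carr X"
  shows "env_norm X (\<Sum>i\<in>I. F i) \<le> (\<Sum>i\<in>I. env_norm X (F i))"
proof -
  interpret V: vector_space "scal X" using X by (simp add: quasi_normed_def)
  have zero: "env_norm X 0 = 0"
    using env_norm_scale[OF X subspace_closed(1)[OF X], of 0] by simp
  have sub: "V.subspace (carr X)" using X by (simp add: quasi_normed_def)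
  show ?thesis using assms(2)
  proof (induction I rule: infinite_finite_induct)
    case (insert i I)
    have "env_norm X (F i + (\<Sum>i\<in>I. F i)) \<le> env_norm X (F i) + env_norm X (\<Sum>i\<in>I. F i)"
      using insert.prems by (intro env_norm_add[OF X] V.subspace_sum[OF sub]) auto
    then show ?case using insert by force
  qed (auto simp: zero)
qed

section \<open>The Banach envelope as a sequence space\<close>

context monotone_seminorms
begin

text \<open>
  Cutting to the first \<open>N\<close> coordinates is a contraction of \<open>X\<close>, hence of the envelope seminorm.
  Therefore the unit vectors stay a monotone basis in the envelope, the coordinates determine the
  elements of the completion, and the completion can be realized by sequences.
\<close>

definition env_seminorm :: "nat \<Rightarrow> (nat \<Rightarrow> 'f) \<Rightarrow> real" where
  "env_seminorm N f = env_norm X (head N f)"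

lemma quasi_normed_scalars: "quasi_normed (scalars :: ('f, 'f) qspace) 1"
proof -
  have vs: "vector_space ((*) :: 'f \<Rightarrow> 'f \<Rightarrow> 'f)" by unfold_locales (auto simp: algebra_simps)
  then interpret V: vector_space "(*) :: 'f \<Rightarrow> 'f \<Rightarrow> 'f" .
  show ?thesis unfolding quasi_normed_def using vs
    by (auto simp: scalars_def norm_mult norm_triangle_ineq)
qed

text \<open>
  Every functional of norm at most one on \<open>X\<close> bounds the envelope seminorm from below; it is the
  universal property for the field of scalars.
\<close>

lemma functional_le_env_norm:
  assumes "linear_betw X scalars T" "\<And>f. f \<in> carr X \<Longrightarrow> norm (T f) \<le> qnorm X f" "f \<in> carr X"
  shows "norm (T f) \<le> env_norm X f"
proof -
  have "qnorm scalars (T f) \<le> 1 * env_norm X f"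
    using assms(2) by (intro bound_env_norm[OF quasi_normed_seq_space quasi_normed_scalars assms(1)]
        assms(3)) (force simp: scalars_def)+
  then show ?thesis by (simp add: scalars_def)
qed

lemma coord_le_env_norm: "f \<in> carr X \<Longrightarrow> norm (f n) \<le> env_norm X f"
  using functional_le_env_norm[of "\<lambda>f. f n" f] coord_le_qnorm coord_cont_linear[of n]
  by (simp add: cont_linear_def)

lemma quasi_normed_env_norm: "quasi_normed (X\<lparr>qnorm := env_norm X\<rparr>) 1"
proof -
  note X = quasi_normed_seq_space
  have zero: "env_norm X f = 0 \<longleftrightarrow> f = 0" if "f \<in> carr X" for f
  proof
    assume "env_norm X f = 0"
    then show "f = 0" using coord_le_env_norm[OF that] by (auto simp: fun_eq_iff)
  next
    assume "f = 0"
    then show "env_norm X f = 0"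
      using env_norm_le[OF X carr_zero] env_norm_nonneg[OF X carr_zero] qnorm_zero by simp
  qed
  have "module.subspace seq_scale (carr X)" using X by (simp add: quasi_normed_def)
  then show ?thesis
    unfolding quasi_normed_def
    using zero env_norm_add[OF X] env_norm_scale[OF X] env_norm_nonneg[OF X]
    by (simp add: vector_space_seq_scale)
qed

lemma qnorm_head_le: "f \<in> carr X \<Longrightarrow> qnorm X (head N f) \<le> qnorm X f"
  using r_head_le r_le_qnorm by (intro qnorm_le) (meson order_trans)

text \<open>
  The cutting operator is viewed as a contraction from \<open>X\<close> into the same carrier with the envelope
  norm. That target is locally convex, so its bound on the unit ball extends to the convex hull.
\<close>

lemma env_norm_head_le:
  assumes "f \<in> carr X"
  shows "env_norm X (head N f) \<le> env_norm X f"
proof -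
  note X = quasi_normed_seq_space
  have lin: "linear_betw X (X\<lparr>qnorm := env_norm X\<rparr>) (head N)"
    unfolding linear_betw_def using head_carr by (auto simp: restr_add restr_seq_scale)
  have "qnorm (X\<lparr>qnorm := env_norm X\<rparr>) (head N g) \<le> 1" if "g \<in> carr X" "qnorm X g \<le> 1" for g
    using env_norm_le[OF X head_carr, of N g] qnorm_head_le[OF that(1), of N] that(2) by simp
  from bound_env_norm[OF X quasi_normed_env_norm lin zero_le_one this assms]
  show ?thesis by simp
qed

lemma env_seminorms: "monotone_seminorms env_seminorm 1"
proof
  note X = quasi_normed_seq_space
  fix N M n :: nat and f g :: "nat \<Rightarrow> 'f" and c :: 'f
  show "env_seminorm N (f + g) \<le> 1 * (env_seminorm N f + env_seminorm N g)"
    unfolding env_seminorm_def using env_norm_add[OF X head_carr head_carr] by (simp add: restr_add)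
  show "env_seminorm N (seq_scale c f) = norm c * env_seminorm N f"
    unfolding env_seminorm_def using env_norm_scale[OF X head_carr] by (simp add: restr_seq_scale)
  have Int: "{..<M} \<inter> {..<N} = {..<min M N}" by auto
  then show "env_seminorm M (head N f) = env_seminorm (min M N) f"
    by (simp add: env_seminorm_def restr_restr)
  show "env_seminorm N f \<le> env_seminorm M f" if "N \<le> M"
  proof -
    have "head N f = head N (head M f)" using that by (auto simp: restr_apply fun_eq_iff)
    then show ?thesis unfolding env_seminorm_def using env_norm_head_le[OF head_carr] by metis
  qed
  show "norm (f n) \<le> env_seminorm N f" if "n < N"
    unfolding env_seminorm_def using coord_le_env_norm[OF head_carr, of N f n] that
    by (simp add: restr_apply)
  show "env_seminorm N f \<le> (\<Sum>n<N. norm (f n))"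
    unfolding env_seminorm_def
    using env_norm_le[OF X head_carr, of N f] qnorm_restr_le[of "{..<N}" f] by simp
qed simp

interpretation env: monotone_seminorms env_seminorm 1
  by (rule env_seminorms)

lemma env_seminorm_le_qnorm:
  assumes "\<And>K. r K f \<le> C"
  shows "env_seminorm M f \<le> C"
proof -
  have "env_seminorm M f \<le> qnorm X (head M f)"
    unfolding env_seminorm_def by (rule env_norm_le[OF quasi_normed_seq_space head_carr])
  also have "\<dots> \<le> C" using assms r_head_le by (intro qnorm_le) (meson order_trans)
  finally show ?thesis .
qed

lemma carr_env:
  assumes "f \<in> carr X"
  shows "f \<in> carr (seq_space env_seminorm)"
proof (rule env.carrI)
  fix e :: real assume "0 < e"
  then obtain N where "\<And>K M. N \<le> K \<Longrightarrow> r M (f - head K f) \<le> e"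
    using carr_tail[OF assms] by blast
  then have "r M (f - head N f) \<le> e" for M by simp
  then show "\<exists>N. \<forall>M. env_seminorm M (f - head N f) \<le> e" using env_seminorm_le_qnorm by blast
qed

text \<open>
  The supremum of the norms of the initial segments recovers the envelope norm, since the tails
  tend to zero already in the larger quasi-norm of \<open>X\<close>.
\<close>

lemma qnorm_env:
  assumes f: "f \<in> carr X"
  shows "qnorm (seq_space env_seminorm) f = env_norm X f"
proof (rule antisym)
  note X = quasi_normed_seq_space
  show "qnorm (seq_space env_seminorm) f \<le> env_norm X f"
    using env_norm_head_le[OF f] by (intro env.qnorm_le) (simp add: env_seminorm_def)
  show "env_norm X f \<le> qnorm (seq_space env_seminorm) f"
  proof (rule field_le_epsilon)
    fix e :: real assume "0 < e"
    then obtain N where "\<And>K M. N \<le> K \<Longrightarrow> r M (f - head K f) \<le> e"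
      using carr_tail[OF f] by blast
    then have "r M (f - head N f) \<le> e" for M by simp
    then have "qnorm X (f - head N f) \<le> e" by (rule qnorm_le)
    then have tail: "env_norm X (f - head N f) \<le> e"
      using env_norm_le[OF X carr_diff[OF f head_carr], of N f] by linarith
    have "env_norm X f \<le> env_norm X (head N f) + env_norm X (f - head N f)"
      using env_norm_add[OF X head_carr carr_diff[OF f head_carr], of N f N f] by simp
    also have "env_norm X (head N f) \<le> qnorm (seq_space env_seminorm) f"
      using env.r_le_qnorm[OF carr_env[OF f], of N] by (simp add: env_seminorm_def)
    finally show "env_norm X f \<le> qnorm (seq_space env_seminorm) f + e" using tail by linarith
  qed
qed

theorem banach_envelope_seq_space: "banach_envelope X (seq_space env_seminorm) id"
  unfolding banach_envelope_def
proof (intro conjI ballI allI impI)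
  show "banach_space (seq_space env_seminorm)"
    unfolding banach_space_def using env.quasi_normed_seq_space env.complete_seq_space by blast
  show "linear_betw X (seq_space env_seminorm) id"
    unfolding linear_betw_def using carr_env by auto
  show "qnorm (seq_space env_seminorm) (id f) = env_norm X f" if "f \<in> carr X" for f
    using qnorm_env[OF that] by simp
  fix g and e :: real
  assume g: "g \<in> carr (seq_space env_seminorm)" and e: "0 < e"
  obtain N where "norm (qnorm (seq_space env_seminorm) (head N g - g) - 0) < e"
    using LIMSEQ_D[OF env.head_converges[OF g] e] by blast
  moreover have "qnorm (seq_space env_seminorm) (head N g - g) = qnorm (seq_space env_seminorm) (g - head N g)"
    by (simp add: env.qnorm_X env.r_swap)
  ultimately show "\<exists>f\<in>carr X. qnorm (seq_space env_seminorm) (g - id f) < e"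
    using head_carr by (intro bexI[of _ "head N g"]) auto
qed

end

section \<open>Two inequalities for powers\<close>

text \<open>
  Jensen's inequality with weights of total mass at most one. The missing mass only helps, as if
  it were placed at zero.
\<close>

lemma powr_sum_le:
  fixes b :: "'i \<Rightarrow> real"
  assumes J: "finite J" and w: "\<And>j. j \<in> J \<Longrightarrow> 0 \<le> w j" "(\<Sum>j\<in>J. w j) \<le> 1"
    and b: "\<And>j. j \<in> J \<Longrightarrow> 0 \<le> b j" and Q: "1 \<le> Q"
  shows "(\<Sum>j\<in>J. w j * b j) powr Q \<le> (\<Sum>j\<in>J. w j * b j powr Q)"
proof -
  \<comment> \<open>The terms that vanish are discarded, since the convexity of the power is available on
    positive numbers; the remaining weights are then normalized.\<close>
  define J' where "J' = {j \<in> J. 0 < w j \<and> 0 < b j}"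
  define W where "W = (\<Sum>j\<in>J'. w j)"
  have J': "finite J'" "J' \<subseteq> J" using J by (auto simp: J'_def)
  have zero: "w j = 0 \<or> b j = 0" if "j \<in> J - J'" for j
    using that w(1)[of j] b[of j] by (auto simp: J'_def)
  have s1: "(\<Sum>j\<in>J. w j * b j) = (\<Sum>j\<in>J'. w j * b j)"
    using J J' zero by (intro sum.mono_neutral_right) auto
  have s2: "(\<Sum>j\<in>J. w j * b j powr Q) = (\<Sum>j\<in>J'. w j * b j powr Q)"
    using J J' zero by (intro sum.mono_neutral_right) fastforce+
  show ?thesis
  proof (cases "J' = {}")
    case True
    then show ?thesis unfolding s1 s2 by simp
  next
    case False
    have W: "0 < W" unfolding W_def using J' False by (intro sum_pos) (auto simp: J'_def)
    have "W \<le> (\<Sum>j\<in>J. w j)" unfolding W_def using J J' w by (intro sum_mono2) auto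
    then have W1: "W \<le> 1" using w(2) by linarith
    have "(\<Sum>j\<in>J'. (w j / W) *\<^sub>R b j) powr Q \<le> (\<Sum>j\<in>J'. (w j / W) * b j powr Q)"
    proof (rule convex_on_sum[OF J'(1) False powr_convex[OF Q]])
      show "(\<Sum>j\<in>J'. w j / W) = 1" using W by (simp add: W_def flip: sum_divide_distrib)
    qed (use W in \<open>auto simp: J'_def\<close>)
    then have jensen: "((\<Sum>j\<in>J'. w j * b j) / W) powr Q \<le> (\<Sum>j\<in>J'. w j * b j powr Q) / W"
      by (simp add: sum_divide_distrib)
    have nn: "0 \<le> (\<Sum>j\<in>J'. w j * b j)" "0 \<le> (\<Sum>j\<in>J'. w j * b j powr Q)"
      by (intro sum_nonneg, simp add: J'_def)+
    have "(\<Sum>j\<in>J'. w j * b j) powr Q = W powr Q * ((\<Sum>j\<in>J'. w j * b j) / W) powr Q"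
      using W nn by (simp add: powr_divide)
    also have "\<dots> \<le> W powr Q * ((\<Sum>j\<in>J'. w j * b j powr Q) / W)"
      using jensen by (intro mult_left_mono) auto
    also have "\<dots> = W powr (Q - 1) * (\<Sum>j\<in>J'. w j * b j powr Q)"
      using W by (simp add: powr_diff)
    also have "\<dots> \<le> 1 * (\<Sum>j\<in>J'. w j * b j powr Q)"
      using nn W W1 Q by (intro mult_right_mono powr_le1) auto
    finally show ?thesis unfolding s1 s2 by simp
  qed
qed

text \<open>
  The sum \<open>2 * (1 + 2 powr (1 - Q) + 2 powr (2 * (1 - Q)) + \<dots>)\<close> of the geometric series
  over the dyadic layers in the next lemma.
\<close>

definition weak_moment_const :: "real \<Rightarrow> real" where
  "weak_moment_const Q = 2 / (1 - 2 powr (1 - Q))"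

lemma weak_moment_const_pos: "1 < Q \<Longrightarrow> 0 < weak_moment_const Q"
  using powr_less_mono[of "1 - Q" 0 2] by (simp add: weak_moment_const_def)

text \<open>
  Weak summability says that a dyadic layer \<open>t / 2 \<le> a n < t\<close> has at most \<open>2 * c / t\<close> members, so
  that it contributes at most \<open>2 * c * t powr (Q - 1)\<close>. For \<open>Q > 1\<close> these contributions decay
  geometrically with \<open>t\<close>.
\<close>

lemma weak_truncated_moment:
  fixes a :: "'i \<Rightarrow> real"
  assumes I: "finite I" and a: "\<And>n. n \<in> I \<Longrightarrow> 0 \<le> a n" and Q: "1 < Q" and t: "0 < t"
    and weak: "\<And>s. 0 < s \<Longrightarrow> s * real (card {n \<in> I. s \<le> a n}) \<le> c"
  shows "(\<Sum>n\<in>{n \<in> I. a n < t}. a n powr Q) \<le> weak_moment_const Q * c * t powr (Q - 1)"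
proof -
  define F where "F t = (\<Sum>n\<in>{n \<in> I. a n < t}. a n powr Q)" for t
  let ?K = "weak_moment_const Q"
  have K: "0 < ?K" using Q by (rule weak_moment_const_pos)
  have c: "0 \<le> c" using weak[OF t] t by (meson order_trans mult_nonneg_nonneg less_imp_le of_nat_0_le_iff)
  have half: "F t \<le> F (t / 2) + 2 * c * t powr (Q - 1)" if t: "0 < t" for t
  proof -
    let ?D = "{n \<in> I. t / 2 \<le> a n \<and> a n < t}"
    have "{n \<in> I. a n < t} = {n \<in> I. a n < t / 2} \<union> ?D" using t by auto
    then have "F t = (\<Sum>n\<in>{n \<in> I. a n < t / 2} \<union> ?D. a n powr Q)" by (simp add: F_def)
    also have "\<dots> = F (t / 2) + (\<Sum>n\<in>?D. a n powr Q)"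
      unfolding F_def using I by (intro sum.union_disjoint) auto
    also have "(\<Sum>n\<in>?D. a n powr Q) \<le> (\<Sum>n\<in>?D. t powr Q)"
      using a Q by (intro sum_mono powr_mono2) auto
    also have "\<dots> = real (card ?D) * t powr Q" by simp
    also have "\<dots> \<le> real (card {n \<in> I. t / 2 \<le> a n}) * t powr Q"
      using I by (intro mult_right_mono of_nat_mono card_mono) auto
    also have "\<dots> \<le> (2 * c / t) * t powr Q"
      using weak[of "t / 2"] t by (intro mult_right_mono) (auto simp: field_simps)
    also have "\<dots> = 2 * c * t powr (Q - 1)" using t by (simp add: powr_diff)
    finally show ?thesis by simp
  qed
  define P where "P = a ` {n \<in> I. 0 < a n}"
  define d where "d = (if P = {} then 1 else Min P)"
  have P: "finite P" using I by (simp add: P_def)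
  have d: "0 < d"
  proof (cases "P = {}")
    case False
    then have "Min P \<in> P" using P by (intro Min_in)
    then show ?thesis using False by (auto simp: d_def P_def)
  qed (simp add: d_def)
  have small: "a n = 0" if "n \<in> I" "a n < d" for n
  proof (rule ccontr)
    assume "a n \<noteq> 0"
    then have "a n \<in> P" using that a[of n] by (auto simp: P_def)
    then have "d \<le> a n" using P by (auto simp: d_def)
    then show False using that by simp
  qed
  have step: "0 < t \<Longrightarrow> t \<le> 2 ^ k * d \<Longrightarrow> F t \<le> ?K * c * t powr (Q - 1)" for k t
  proof (induction k arbitrary: t)
    case 0
    then have "F t = 0" unfolding F_def using small Q by (intro sum.neutral) force
    then show ?case using K c by simp
  next
    case (Suc k)
    have "F t \<le> F (t / 2) + 2 * c * t powr (Q - 1)" using half Suc.prems by blast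
    also have "F (t / 2) \<le> ?K * c * (t / 2) powr (Q - 1)" using Suc by simp
    also have "(t / 2) powr (Q - 1) = 2 powr (1 - Q) * t powr (Q - 1)"
      using Suc.prems by (simp add: powr_divide powr_diff)
    also have "?K * c * (2 powr (1 - Q) * t powr (Q - 1)) + 2 * c * t powr (Q - 1)
        = (?K * 2 powr (1 - Q) + 2) * (c * t powr (Q - 1))" by (simp add: algebra_simps)
    also have "?K * 2 powr (1 - Q) + 2 = ?K"
    proof -
      have "?K * (1 - 2 powr (1 - Q)) = 2"
        unfolding weak_moment_const_def using powr_less_mono[of "1 - Q" 0 2] Q
        by (intro nonzero_eq_divide_eq[THEN iffD1]) auto
      then show ?thesis by (simp add: algebra_simps)
    qed
    finally show ?case by (simp add: mult.assoc)
  qed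
  obtain k where "t / d < 2 ^ k" using real_arch_pow[of 2 "t / d"] by auto
  then have "t \<le> 2 ^ k * d" using d by (simp add: field_simps)
  then show ?thesis using step[OF t] by (simp add: F_def)
qed

section \<open>Sums over level sets\<close>

definition level_set :: "real \<Rightarrow> nat \<Rightarrow> (nat \<Rightarrow> 'f::real_normed_vector) \<Rightarrow> nat set" where
  "level_set t M f = {n. n < M \<and> t \<le> norm (f n)}"

text \<open>
  The first term under the supremum is the weak \<open>\<ell>\<^sub>1\<close> quasi-norm. The second term, the sum of the
  coefficients that are large, keeps the sign information that a lattice quasi-norm would lose.
  Both are homogeneous, since scaling a sequence scales the thresholds.
\<close>

definition level_norm :: "nat \<Rightarrow> (nat \<Rightarrow> 'f::real_normed_field) \<Rightarrow> real" where
  "level_norm N f = (SUP (t, M)\<in>{0<..} \<times> {..N}.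
     max (t * real (card (level_set t M f))) (norm (\<Sum>n\<in>level_set t M f. f n)))"

lemma finite_level_set [simp]: "finite (level_set t M f)"
  by (simp add: level_set_def)

lemma level_card_le_sum:
  fixes f :: "nat \<Rightarrow> 'f::real_normed_field"
  assumes "M \<le> N"
  shows "t * real (card (level_set t M f)) \<le> (\<Sum>n<N. norm (f n))"
    and "norm (\<Sum>n\<in>level_set t M f. f n) \<le> (\<Sum>n<N. norm (f n))"
proof -
  have sub: "(\<Sum>n\<in>level_set t M f. norm (f n)) \<le> (\<Sum>n<N. norm (f n))"
    using assms by (intro sum_mono2) (auto simp: level_set_def)
  have "t * real (card (level_set t M f)) = (\<Sum>n\<in>level_set t M f. t)" by simp
  also have "\<dots> \<le> (\<Sum>n\<in>level_set t M f. norm (f n))" by (intro sum_mono) (auto simp: level_set_def)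
  finally show "t * real (card (level_set t M f)) \<le> (\<Sum>n<N. norm (f n))" using sub by linarith
  show "norm (\<Sum>n\<in>level_set t M f. f n) \<le> (\<Sum>n<N. norm (f n))"
    using sub norm_sum[of f "level_set t M f"] by linarith
qed

lemma level_norm_le_iff:
  fixes f :: "nat \<Rightarrow> 'f::real_normed_field"
  shows "level_norm N f \<le> C \<longleftrightarrow> (\<forall>t M. 0 < t \<and> M \<le> N \<longrightarrow>
     t * real (card (level_set t M f)) \<le> C \<and> norm (\<Sum>n\<in>level_set t M f. f n) \<le> C)"
proof -
  let ?v = "\<lambda>(t, M). max (t * real (card (level_set t M f))) (norm (\<Sum>n\<in>level_set t M f. f n))"
  have bdd: "bdd_above (?v ` ({0<..} \<times> {..N}))"
    using level_card_le_sum[of _ N] by (intro bdd_aboveI2[of _ _ "\<Sum>n<N. norm (f n)"]) auto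
  have ne: "({0<..} :: real set) \<times> {..N} \<noteq> {}" by (metis SigmaI atMost_iff empty_iff greaterThan_iff le0 zero_less_one)
  show ?thesis unfolding level_norm_def cSUP_le_iff[OF ne bdd] by auto
qed

lemma level_normI:
  fixes f :: "nat \<Rightarrow> 'f::real_normed_field"
  assumes "\<And>t M. 0 < t \<Longrightarrow> M \<le> N \<Longrightarrow> t * real (card (level_set t M f)) \<le> C"
    and "\<And>t M. 0 < t \<Longrightarrow> M \<le> N \<Longrightarrow> norm (\<Sum>n\<in>level_set t M f. f n) \<le> C"
  shows "level_norm N f \<le> C"
  using assms by (simp add: level_norm_le_iff)

lemma level_normD:
  fixes f :: "nat \<Rightarrow> 'f::real_normed_field"
  assumes "0 < t" "M \<le> N"
  shows card_le_level_norm: "t * real (card (level_set t M f)) \<le> level_norm N f"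
    and sum_le_level_norm: "norm (\<Sum>n\<in>level_set t M f. f n) \<le> level_norm N f"
  using assms level_norm_le_iff[of N f "level_norm N f"] by auto

lemma level_norm_le_sum: "level_norm N f \<le> (\<Sum>n<N. norm (f n))"
  by (rule level_normI) (auto intro: level_card_le_sum)

lemma level_norm_nonneg: "0 \<le> level_norm N f"
  using sum_le_level_norm[of 1 N N f] norm_ge_zero by (meson order_trans order_refl zero_less_one)

lemma coord_le_level_norm:
  assumes "n < N"
  shows "norm (f n) \<le> level_norm N f"
proof (cases "f n = 0")
  case False
  have "{n} \<subseteq> level_set (norm (f n)) N f" using assms by (simp add: level_set_def)
  then have "card {n} \<le> card (level_set (norm (f n)) N f)" by (intro card_mono) auto
  then have "norm (f n) * 1 \<le> norm (f n) * real (card (level_set (norm (f n)) N f))"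
    by (intro mult_left_mono) auto
  also have "\<dots> \<le> level_norm N f" using False by (intro card_le_level_norm) auto
  finally show ?thesis by simp
qed (simp add: level_norm_nonneg)

lemma level_norm_scale_le:
  assumes c: "c \<noteq> 0"
  shows "level_norm N (seq_scale c f) \<le> norm c * level_norm N f"
proof (rule level_normI)
  fix t :: real and M assume t: "0 < t" "M \<le> N"
  have L: "level_set t M (seq_scale c f) = level_set (t / norm c) M f"
    using c by (auto simp: level_set_def norm_mult field_simps)
  have tc: "0 < t / norm c" using t c by simp
  have "t * real (card (level_set t M (seq_scale c f)))
      = norm c * (t / norm c * real (card (level_set (t / norm c) M f)))"
    using c by (simp add: L)
  also have "\<dots> \<le> norm c * level_norm N f"
    by (intro mult_left_mono card_le_level_norm tc t) simp
  finally show "t * real (card (level_set t M (seq_scale c f))) \<le> norm c * level_norm N f" .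
  have "norm (\<Sum>n\<in>level_set t M (seq_scale c f). seq_scale c f n)
      = norm c * norm (\<Sum>n\<in>level_set (t / norm c) M f. f n)"
    by (simp add: L norm_mult flip: sum_distrib_left)
  also have "\<dots> \<le> norm c * level_norm N f"
    by (intro mult_left_mono sum_le_level_norm tc t) simp
  finally show "norm (\<Sum>n\<in>level_set t M (seq_scale c f). seq_scale c f n) \<le> norm c * level_norm N f" .
qed

lemma level_norm_scale: "level_norm N (seq_scale c f) = norm c * level_norm N f"
proof (cases "c = 0")
  case True
  then show ?thesis using level_norm_le_sum[of N "seq_scale c f"] level_norm_nonneg[of N "seq_scale c f"] by simp
next
  case False
  have "f = seq_scale (inverse c) (seq_scale c f)" using False by auto
  then have "level_norm N f \<le> norm (inverse c) * level_norm N (seq_scale c f)"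
    using level_norm_scale_le[of "inverse c" N "seq_scale c f"] False by simp
  then have "norm c * level_norm N f \<le> level_norm N (seq_scale c f)"
    using False by (simp add: norm_divide field_simps)
  then show ?thesis using level_norm_scale_le[OF False, of N f] by linarith
qed

lemma level_norm_head: "level_norm M (head N f) = level_norm (min M N) f"
proof (rule antisym)
  have L: "level_set t K (head N f) = level_set t (min K N) f" if "0 < t" for t K
    using that by (auto simp: level_set_def restr_apply)
  have S: "(\<Sum>n\<in>level_set t (min K N) f. head N f n) = (\<Sum>n\<in>level_set t (min K N) f. f n)" for t K
    by (rule sum.cong) (auto simp: level_set_def restr_apply)
  show "level_norm M (head N f) \<le> level_norm (min M N) f"
    by (rule level_normI) (auto simp: L S intro!: level_normD)
  show "level_norm (min M N) f \<le> level_norm M (head N f)"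
  proof (rule level_normI)
    fix t :: real and K assume t: "0 < t" "K \<le> min M N"
    then have K: "min K N = K" by simp
    show "t * real (card (level_set t K f)) \<le> level_norm M (head N f)"
      using card_le_level_norm[of t K M "head N f"] t by (simp add: L K)
    show "norm (\<Sum>n\<in>level_set t K f. f n) \<le> level_norm M (head N f)"
      using sum_le_level_norm[of t K M "head N f"] S[of t K] t by (simp add: L K)
  qed
qed

lemma level_norm_mono: "N \<le> M \<Longrightarrow> level_norm N f \<le> level_norm M f"
  by (rule level_normI) (auto intro!: level_normD)

section \<open>Local convexity\<close>

definition level_convexity_const :: "real \<Rightarrow> real" where
  "level_convexity_const p = 3 + 3 * weak_moment_const (1 / p)"

text \<open>
  The weak \<open>\<ell>\<^sub>1\<close> part is \<open>p\<close>-convex for every \<open>p < 1\<close>: outside the set \<open>G\<close> where some summand is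
  large, which has at most \<open>1 / t\<close> elements, only the truncations below \<open>t\<close> matter, and the sum of
  these has a moment of order \<open>Q = 1 / p > 1\<close> that is at most a constant times \<open>t powr (Q - 1)\<close>.

  For the thresholded sums, let \<open>big\<close> be the identity cut off to arguments of modulus at least \<open>t\<close>.
  The deviation \<open>R n\<close> of \<open>big\<close> from additivity equals, up to sign, the deviation of the
  complementary cut-off \<open>small\<close>, so it is at most \<open>U n + t\<close>. It vanishes outside the set
  \<open>G \<union> H\<close> where a summand or the total is large, and that set has \<open>O(1 / t)\<close> elements. Hence the
  deviations have a bounded sum, whatever the threshold, and the sums of the \<open>big (F j n)\<close>
  themselves are at most \<open>c j\<close>.
\<close>

lemma level_norm_sum_normalized:
  fixes F :: "'j \<Rightarrow> nat \<Rightarrow> 'f::real_normed_field"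
  assumes J: "finite J" and p: "0 < p" "p < 1"
    and F: "\<And>j. j \<in> J \<Longrightarrow> level_norm N (F j) \<le> c j"
    and c: "(\<Sum>j\<in>J. c j powr p) \<le> 1"
  shows "level_norm N (\<Sum>j\<in>J. F j) \<le> level_convexity_const p"
proof -
  define Q where "Q = 1 / p"
  have Q: "1 < Q" using p by (simp add: Q_def)
  define K where "K = weak_moment_const Q"
  have K: "0 < K" unfolding K_def using Q by (rule weak_moment_const_pos)
  have C: "level_convexity_const p = 3 + 3 * K" by (simp add: level_convexity_const_def K_def Q_def)
  have c0: "0 \<le> c j" if "j \<in> J" for j using F[OF that] level_norm_nonneg[of N "F j"] by linarith
  have c_le: "c j \<le> c j powr p" if "j \<in> J" for j
  proof (cases "c j = 0")
    case False
    have "c j powr p \<le> (\<Sum>j\<in>J. c j powr p)" using J that by (intro member_le_sum) auto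
    then have "c j powr p \<le> 1" using c by linarith
    then have "c j \<le> 1"
      using p c0[OF that] by (metis powr_less_mono2 powr_one_eq_one not_le zero_le_one)
    then show ?thesis
      using powr_mono'[of p 1 "c j"] p c0[OF that] False by simp
  qed simp
  then have csum: "(\<Sum>j\<in>J. c j) \<le> 1" using c sum_mono[of J c "\<lambda>j. c j powr p"] by force
  define S where "S = (\<Sum>j\<in>J. F j)"
  have S: "S n = (\<Sum>j\<in>J. F j n)" for n by (simp add: S_def sum_seq_apply)
  have main: "t * real (card (level_set t M S)) \<le> 1 + K \<and>
      norm (\<Sum>n\<in>level_set t M S. S n) \<le> 3 + 3 * K" if t: "0 < t" and M: "M \<le> N" for t M
  proof -
    define big where "big s = (if t \<le> norm s then s else 0)" for s :: 'f
    define small where "small s = (if t \<le> norm s then 0 else s)" for s :: 'f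
    have split: "s = big s + small s" for s by (simp add: big_def small_def)
    have small_le: "norm (small s) \<le> t" for s using t by (auto simp: small_def)
    define U where "U n = (\<Sum>j\<in>J. norm (small (F j n)))" for n
    have U0: "0 \<le> U n" for n by (simp add: U_def sum_nonneg)
    \<comment> \<open>Weights \<open>c j powr p\<close> balance the truncated moments of the summands.\<close>
    have moment: "(\<Sum>n<M. U n powr Q) \<le> K * t powr (Q - 1)"
    proof -
      define w where "w j = c j powr p" for j
      have wQ: "w j powr Q = c j" if "j \<in> J" for j
        using p c0[OF that] by (simp add: w_def Q_def powr_powr)
      have zero: "F j n = 0" if "j \<in> J" "w j = 0" "n < M" for j n
      proof -
        have "c j = 0" using that by (simp add: w_def)
        then have "norm (F j n) \<le> 0"
          using coord_le_level_norm[of n N "F j"] F[OF that(1)] that(3) M by linarith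
        then show ?thesis by simp
      qed
      have "(\<Sum>n<M. U n powr Q) \<le> (\<Sum>n<M. \<Sum>j\<in>J. w j * (norm (small (F j n)) / w j) powr Q)"
      proof (rule sum_mono)
        fix n assume n: "n \<in> {..<M}"
        have "norm (small (F j n)) = w j * (norm (small (F j n)) / w j)" if "j \<in> J" for j
          using zero[OF that, of n] n t by (auto simp: small_def)
        then have "U n = (\<Sum>j\<in>J. w j * (norm (small (F j n)) / w j))"
          unfolding U_def by (intro sum.cong) auto
        moreover have "(\<Sum>j\<in>J. w j * (norm (small (F j n)) / w j)) powr Q
            \<le> (\<Sum>j\<in>J. w j * (norm (small (F j n)) / w j) powr Q)"
          using c Q by (intro powr_sum_le J) (auto simp: w_def)
        ultimately show "U n powr Q \<le> (\<Sum>j\<in>J. w j * (norm (small (F j n)) / w j) powr Q)" by simp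
      qed
      also have "\<dots> = (\<Sum>j\<in>J. w j * (\<Sum>n<M. (norm (small (F j n)) / w j) powr Q))"
        by (simp add: sum_distrib_left sum.swap[of _ J])
      also have "\<dots> \<le> (\<Sum>j\<in>J. w j * (K * t powr (Q - 1)))"
      proof (rule sum_mono)
        fix j assume j: "j \<in> J"
        show "w j * (\<Sum>n<M. (norm (small (F j n)) / w j) powr Q) \<le> w j * (K * t powr (Q - 1))"
        proof (cases "w j = 0")
          case False
          then have w: "0 < w j" "0 < c j" using c0[OF j] by (auto simp: w_def)
          have weak: "s * real (card {n \<in> {..<M}. s \<le> norm (F j n)}) \<le> c j" if "0 < s" for s
          proof -
            have "{n \<in> {..<M}. s \<le> norm (F j n)} = level_set s M (F j)" by (auto simp: level_set_def)
            then show ?thesis using card_le_level_norm[OF that M, of "F j"] F[OF j] by simp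
          qed
          have "(\<Sum>n<M. norm (small (F j n)) powr Q)
              = (\<Sum>n\<in>{n \<in> {..<M}. norm (F j n) < t}. norm (F j n) powr Q)"
            by (rule sum.mono_neutral_cong_right) (auto simp: small_def)
          also have "\<dots> \<le> K * c j * t powr (Q - 1)"
            unfolding K_def using weak Q t by (intro weak_truncated_moment) auto
          finally have "(\<Sum>n<M. norm (small (F j n)) powr Q) / c j \<le> K * t powr (Q - 1)"
            using w by (simp add: field_simps)
          moreover have "(\<Sum>n<M. (norm (small (F j n)) / w j) powr Q)
              = (\<Sum>n<M. norm (small (F j n)) powr Q) / c j"
            using w by (simp add: powr_divide wQ[OF j] sum_divide_distrib)
          ultimately show ?thesis using w by (intro mult_left_mono) auto
        qed simp
      qed
      also have "\<dots> = (\<Sum>j\<in>J. w j) * (K * t powr (Q - 1))" by (simp add: sum_distrib_right)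
      also have "\<dots> \<le> 1 * (K * t powr (Q - 1))"
        using c K by (intro mult_right_mono) (auto simp: w_def)
      finally show ?thesis by simp
    qed
    define G where "G = (\<Union>j\<in>J. level_set t M (F j))"
    define H where "H = level_set t M S - G"
    have fin: "finite G" "finite H" using J by (auto simp: G_def H_def)
    have G: "t * real (card G) \<le> 1"
    proof -
      have "t * real (card G) \<le> t * real (\<Sum>j\<in>J. card (level_set t M (F j)))"
        unfolding G_def using t J by (intro mult_left_mono of_nat_mono card_UN_le) auto
      also have "\<dots> = (\<Sum>j\<in>J. t * real (card (level_set t M (F j))))" by (simp add: sum_distrib_left)
      also have "\<dots> \<le> (\<Sum>j\<in>J. c j)"
        by (intro sum_mono order_trans[OF card_le_level_norm[OF t M] F])
      finally show ?thesis using csum by linarith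
    qed
    have H: "t * real (card H) \<le> K"
    proof -
      have "t \<le> U n" if "n \<in> H" for n
      proof -
        have "F j n = small (F j n)" if "j \<in> J" for j
          using \<open>n \<in> H\<close> that by (auto simp: H_def G_def level_set_def small_def)
        then have "S n = (\<Sum>j\<in>J. small (F j n))" unfolding S by (rule sum.cong[OF refl])
        then have "norm (S n) \<le> U n" unfolding U_def by (simp add: norm_sum)
        then show ?thesis using that by (simp add: H_def level_set_def)
      qed
      then have "(\<Sum>n\<in>H. t powr Q) \<le> (\<Sum>n\<in>H. U n powr Q)"
        using t Q by (intro sum_mono powr_mono2) auto
      also have "\<dots> \<le> (\<Sum>n<M. U n powr Q)"
        by (intro sum_mono2) (auto simp: H_def level_set_def)
      also have "\<dots> \<le> K * t powr (Q - 1)" by (rule moment)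
      finally have "real (card H) * t powr Q \<le> K * t powr (Q - 1)" by simp
      moreover have "t powr Q = t * t powr (Q - 1)" using t by (simp add: powr_diff)
      ultimately show ?thesis using t by (simp add: mult.commute[of t] flip: mult.assoc)
    qed
    have GH: "t * real (card (G \<union> H)) \<le> 1 + K"
    proof -
      have "t * real (card (G \<union> H)) \<le> t * (real (card G) + real (card H))"
        using t card_Un_le[of G H] by (intro mult_left_mono) linarith+
      then show ?thesis using G H by (simp add: distrib_left)
    qed
    have "card (level_set t M S) \<le> card (G \<union> H)" using fin by (intro card_mono) (auto simp: H_def)
    then have "t * real (card (level_set t M S)) \<le> t * real (card (G \<union> H))"
      using t by (intro mult_left_mono) auto
    then have part1: "t * real (card (level_set t M S)) \<le> 1 + K" using GH by linarith
    have level_sum: "(\<Sum>n\<in>level_set t M f. f n) = (\<Sum>n<M. big (f n))" for f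
      by (rule sum.mono_neutral_cong_left) (auto simp: level_set_def big_def)
    \<comment> \<open>The failure of \<open>big\<close> to commute with the sum over \<open>J\<close>.\<close>
    define R where "R n = big (S n) - (\<Sum>j\<in>J. big (F j n))" for n
    have R: "R n = (\<Sum>j\<in>J. small (F j n)) - small (S n)" for n
    proof -
      have "big (S n) = (\<Sum>j\<in>J. big (F j n) + small (F j n)) - small (S n)"
        using split[of "S n"] S[of n] split by (metis (no_types, lifting) add_diff_cancel_right' sum.cong)
      then show ?thesis by (simp add: R_def sum.distrib)
    qed
    have R_le: "norm (R n) \<le> 2 * t + U n powr Q * t powr (1 - Q)" for n
    proof -
      have "norm (R n) \<le> U n + t"
        unfolding R U_def
        by (intro order_trans[OF norm_triangle_ineq4] add_mono norm_sum small_le)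
      also have "U n \<le> t + U n powr Q * t powr (1 - Q)"
      proof (cases "U n \<le> t")
        case False
        have "U n * 1 \<le> U n * (U n / t) powr (Q - 1)"
          using False t Q by (intro mult_left_mono ge_one_powr_ge_zero) auto
        also have "\<dots> = U n powr Q * t powr (1 - Q)"
          using False t by (simp add: powr_divide powr_diff)
        finally show ?thesis using t by simp
      qed (simp add: add_increasing2)
      finally show ?thesis by simp
    qed
    have R0: "R n = 0" if "n < M" "n \<notin> G \<union> H" for n
    proof -
      have "big (F j n) = 0" if "j \<in> J" for j
        using \<open>n < M\<close> \<open>n \<notin> G \<union> H\<close> that by (auto simp: G_def level_set_def big_def)
      moreover have "big (S n) = 0"
        using that by (auto simp: H_def level_set_def big_def)
      ultimately show ?thesis by (simp add: R_def)
    qed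
    have sub: "G \<union> H \<subseteq> {..<M}" by (auto simp: G_def H_def level_set_def)
    have "norm (\<Sum>n<M. R n) \<le> (\<Sum>n<M. norm (R n))" by (rule norm_sum)
    also have "\<dots> = (\<Sum>n\<in>G \<union> H. norm (R n))"
      using sub R0 by (intro sum.mono_neutral_right) auto
    also have "\<dots> \<le> (\<Sum>n\<in>G \<union> H. 2 * t + U n powr Q * t powr (1 - Q))"
      by (intro sum_mono R_le)
    also have "\<dots> = 2 * (t * real (card (G \<union> H))) + (\<Sum>n\<in>G \<union> H. U n powr Q) * t powr (1 - Q)"
      by (simp add: sum.distrib sum_distrib_right)
    also have "\<dots> \<le> 2 * (1 + K) + K * t powr (Q - 1) * t powr (1 - Q)"
    proof (intro add_mono mult_left_mono mult_right_mono GH)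
      have "(\<Sum>n\<in>G \<union> H. U n powr Q) \<le> (\<Sum>n<M. U n powr Q)"
        using sub by (intro sum_mono2) auto
      then show "(\<Sum>n\<in>G \<union> H. U n powr Q) \<le> K * t powr (Q - 1)" using moment by linarith
    qed auto
    also have "\<dots> = 2 + 3 * K" using t by (simp add: mult.assoc flip: powr_add)
    finally have rest: "norm (\<Sum>n<M. R n) \<le> 2 + 3 * K" .
    have "norm (\<Sum>j\<in>J. \<Sum>n<M. big (F j n)) \<le> (\<Sum>j\<in>J. norm (\<Sum>n<M. big (F j n)))"
      by (rule norm_sum)
    also have "\<dots> \<le> (\<Sum>j\<in>J. c j)"
    proof (rule sum_mono)
      fix j assume "j \<in> J"
      then show "norm (\<Sum>n<M. big (F j n)) \<le> c j"
        using sum_le_level_norm[OF t M, of "F j"] F[of j] unfolding level_sum by linarith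
    qed
    finally have "norm (\<Sum>j\<in>J. \<Sum>n<M. big (F j n)) \<le> 1" using csum by linarith
    moreover have "(\<Sum>n<M. big (S n)) = (\<Sum>n<M. R n) + (\<Sum>j\<in>J. \<Sum>n<M. big (F j n))"
      by (simp add: R_def sum_subtractf sum.swap[of _ J])
    ultimately have "norm (\<Sum>n<M. big (S n)) \<le> 3 + 3 * K"
      using rest norm_triangle_ineq[of "\<Sum>n<M. R n" "\<Sum>j\<in>J. \<Sum>n<M. big (F j n)"] by simp
    then show ?thesis using part1 by (simp add: level_sum)
  qed
  have "t * real (card (level_set t M S)) \<le> 3 + 3 * K" if "0 < t" "M \<le> N" for t M
    using main[OF that] K by simp
  then show ?thesis unfolding C S_def[symmetric] using main by (intro level_normI) auto
qed

lemma level_norm_sum_le: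
  fixes F :: "'j \<Rightarrow> nat \<Rightarrow> 'f::real_normed_field"
  assumes J: "finite J" and p: "0 < p" "p < 1"
  shows "level_norm N (\<Sum>j\<in>J. F j)
    \<le> level_convexity_const p * (\<Sum>j\<in>J. level_norm N (F j) powr p) powr (1 / p)"
proof -
  define T where "T = (\<Sum>j\<in>J. level_norm N (F j) powr p)"
  have T0: "0 \<le> T" by (simp add: T_def sum_nonneg)
  show ?thesis
  proof (cases "T = 0")
    case True
    then have "level_norm N (F j) powr p = 0" if "j \<in> J" for j
      using J that by (simp add: T_def sum_nonneg_eq_0_iff)
    then have "F j n = 0" if "j \<in> J" "n < N" for j n
      using coord_le_level_norm[of n N "F j"] that by simp
    then have "(\<Sum>n<N. norm ((\<Sum>j\<in>J. F j) n)) = 0" by (simp add: sum_seq_apply)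
    then show ?thesis using level_norm_le_sum[of N "\<Sum>j\<in>J. F j"] True by (simp flip: T_def)
  next
    case False
    define D where "D = T powr (1 / p)"
    have D: "0 < D" using False T0 by (simp add: D_def)
    have Dp: "D powr p = T" using False T0 p by (simp add: D_def powr_powr)
    let ?G = "\<lambda>j. seq_scale (of_real (inverse D)) (F j)"
    have nG: "level_norm N (?G j) = level_norm N (F j) / D" for j
      unfolding level_norm_scale norm_of_real using D by (simp add: field_simps)
    have "level_norm N (\<Sum>j\<in>J. ?G j) \<le> level_convexity_const p"
    proof (rule level_norm_sum_normalized[OF J p])
      show "level_norm N (?G j) \<le> level_norm N (F j) / D" for j by (simp only: nG)
      have "(\<Sum>j\<in>J. (level_norm N (F j) / D) powr p) = (\<Sum>j\<in>J. level_norm N (F j) powr p / T)"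
        using D by (intro sum.cong refl) (simp add: powr_divide level_norm_nonneg Dp)
      also have "\<dots> = 1" using False by (simp add: T_def flip: sum_divide_distrib)
      finally show "(\<Sum>j\<in>J. (level_norm N (F j) / D) powr p) \<le> 1" by simp
    qed
    moreover have "(\<Sum>j\<in>J. F j) = seq_scale (of_real D) (\<Sum>j\<in>J. ?G j)"
      using D by (simp add: fun_eq_iff sum_seq_apply sum_distrib_left flip: mult.assoc)
    then have "level_norm N (\<Sum>j\<in>J. F j) = D * level_norm N (\<Sum>j\<in>J. ?G j)"
      using D by (simp only: level_norm_scale norm_of_real abs_of_pos)
    ultimately show ?thesis using D by (simp add: D_def T_def mult.commute)
  qed
qed

lemma level_norm_add: "level_norm N (f + g) \<le> 30 * (level_norm N f + level_norm N g)"
proof -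
  define a b where "a = level_norm N f" "b = level_norm N g"
  have ab: "0 \<le> a" "0 \<le> b" by (simp_all add: a_b_def level_norm_nonneg)
  define F where "F j = (if j = 0 then f else g)" for j :: nat
  have "f + g = (\<Sum>j\<in>{0, 1}. F j)" by (simp add: F_def)
  then have "level_norm N (f + g) \<le> level_convexity_const (1 / 2)
      * (\<Sum>j\<in>{0, 1}. level_norm N (F j) powr (1 / 2)) powr (1 / (1 / 2))"
    using level_norm_sum_le[of "{0, 1}" "1 / 2" N F] by simp
  also have "(\<Sum>j\<in>{0, 1}. level_norm N (F j) powr (1 / 2)) powr (1 / (1 / 2)) = (sqrt a + sqrt b)\<^sup>2"
    using ab by (simp add: F_def a_b_def powr_half_sqrt)
  also have "level_convexity_const (1 / 2) = 15"
    by (simp add: level_convexity_const_def weak_moment_const_def powr_minus)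
  also have "(sqrt a + sqrt b)\<^sup>2 \<le> 2 * (a + b)"
  proof -
    have "0 \<le> (sqrt a - sqrt b)\<^sup>2" by simp
    then show ?thesis using ab by (simp add: power2_sum power2_diff)
  qed
  finally have "level_norm N (f + g) \<le> 15 * (2 * (a + b))" by (simp only: mult_left_mono)
  also have "\<dots> = 30 * (level_norm N f + level_norm N g)" by (simp add: a_b_def)
  finally show ?thesis .
qed

lemma level_seminorms:
  "monotone_seminorms (level_norm :: nat \<Rightarrow> (nat \<Rightarrow> 'f::{real_normed_field, banach}) \<Rightarrow> real) 30"
  by standard
    (rule level_norm_add level_norm_scale level_norm_head level_norm_mono
      coord_le_level_norm level_norm_le_sum | simp)+

section \<open>Projections onto greedy sets\<close>

text \<open>
  At a threshold above the smallest modulus on the greedy set, the greedy set contains all indices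
  that count. Below it, the greedy set is a level set up to indices with one common modulus.
  So in both cases the sum over \<open>A\<close> differs little from a sum over a level set.
\<close>

lemma level_norm_restr_greedy:
  fixes f :: "nat \<Rightarrow> 'f::real_normed_field"
  assumes A: "\<And>n k. n \<in> A \<Longrightarrow> k \<notin> A \<Longrightarrow> norm (f k) \<le> norm (f n)"
  shows "level_norm N (restr A f) \<le> 2 * level_norm N f"
    and "level_norm N (restr (- A) f) \<le> 3 * level_norm N f"
proof -
  let ?r = "level_norm N f"
  have r0: "0 \<le> ?r" by (rule level_norm_nonneg)
  have L: "level_set t M (restr B f) = level_set t M f \<inter> B" if "0 < t" for t M B
    using that by (auto simp: level_set_def restr_apply)
  have S: "(\<Sum>n\<in>level_set t M f \<inter> B. restr B f n) = (\<Sum>n\<in>level_set t M f \<inter> B. f n)" for t M B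
    by (rule sum.cong) (auto simp: restr_apply)
  have card: "t * real (card (level_set t M f \<inter> B)) \<le> ?r" if "0 < t" "M \<le> N" for t M B
  proof -
    have "t * real (card (level_set t M f \<inter> B)) \<le> t * real (card (level_set t M f))"
      using that by (intro mult_left_mono of_nat_mono card_mono) auto
    then show ?thesis using card_le_level_norm[OF that, of f] by linarith
  qed
  have sumA: "norm (\<Sum>n\<in>level_set t M f \<inter> A. f n) \<le> 2 * ?r" if t: "0 < t" and M: "M \<le> N" for t M
  proof (cases "level_set t M f \<subseteq> A \<or> level_set t M f \<inter> A = {}")
    case True
    then show ?thesis
      using sum_le_level_norm[OF t M, of f] r0 by (auto simp: Int_absorb2)
  next
    case False
    \<comment> \<open>Here \<open>A'\<close> is the level set at the smallest modulus \<open>norm (f m)\<close> on \<open>A'\<close>, apart from some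
      indices where this very modulus is taken; these are controlled by counting them.\<close>
    then obtain k where k: "k \<in> level_set t M f" "k \<notin> A" by blast
    define A' where "A' = A \<inter> {..<M}"
    have A': "level_set t M f \<inter> A = A'"
      using A k by (force simp: A'_def level_set_def)
    have fin: "finite ((\<lambda>n. norm (f n)) ` A')" "(\<lambda>n. norm (f n)) ` A' \<noteq> {}"
      using False A' by (auto simp: A'_def)
    obtain m where m: "m \<in> A'" "norm (f m) = Min ((\<lambda>n. norm (f n)) ` A')"
      using Min_in[OF fin] by auto
    have le: "norm (f m) \<le> norm (f n)" if "n \<in> A'" for n
      using fin that by (simp add: m(2))
    let ?\<tau> = "norm (f m)"
    have tau: "0 < ?\<tau>" using m(1) A' t by (auto simp: level_set_def)
    let ?L = "level_set ?\<tau> M f"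
    have sub: "A' \<subseteq> ?L" using le by (auto simp: A'_def level_set_def)
    have eq: "norm (f n) = ?\<tau>" if "n \<in> ?L - A'" for n
      using that A[of m n] m(1) by (auto simp: A'_def level_set_def)
    have "(\<Sum>n\<in>A'. f n) = (\<Sum>n\<in>?L. f n) - (\<Sum>n\<in>?L - A'. f n)"
      using sub by (simp add: sum_diff)
    then have "norm (\<Sum>n\<in>A'. f n) \<le> norm (\<Sum>n\<in>?L. f n) + norm (\<Sum>n\<in>?L - A'. f n)"
      by (simp add: norm_triangle_ineq4)
    also have "norm (\<Sum>n\<in>?L - A'. f n) \<le> (\<Sum>n\<in>?L - A'. ?\<tau>)"
      using eq by (intro sum_norm_le) auto
    also have "\<dots> = ?\<tau> * real (card (?L - A'))" by simp
    also have "\<dots> \<le> ?\<tau> * real (card ?L)"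
      by (intro mult_left_mono of_nat_mono card_mono) auto
    also have "\<dots> \<le> ?r" by (rule card_le_level_norm[OF tau M])
    also have "norm (\<Sum>n\<in>?L. f n) \<le> ?r" by (rule sum_le_level_norm[OF tau M])
    finally show ?thesis by (simp add: A')
  qed
  show "level_norm N (restr A f) \<le> 2 * ?r"
  proof (rule level_normI)
    fix t :: real and M assume t: "0 < t" "M \<le> N"
    have "t * real (card (level_set t M f \<inter> A)) \<le> 1 * ?r" using card[OF t] by simp
    also have "\<dots> \<le> 2 * ?r" using r0 by simp
    finally show "t * real (card (level_set t M (restr A f))) \<le> 2 * ?r" by (simp only: L[OF t(1)])
    show "norm (\<Sum>n\<in>level_set t M (restr A f). restr A f n) \<le> 2 * ?r"
      using sumA[OF t] by (simp add: L t S)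
  qed
  show "level_norm N (restr (- A) f) \<le> 3 * ?r"
  proof (rule level_normI)
    fix t :: real and M assume t: "0 < t" "M \<le> N"
    have "t * real (card (level_set t M f \<inter> - A)) \<le> 1 * ?r" using card[OF t] by simp
    also have "\<dots> \<le> 3 * ?r" using r0 by simp
    finally show "t * real (card (level_set t M (restr (- A) f))) \<le> 3 * ?r" by (simp only: L[OF t(1)])
    have "(\<Sum>n\<in>level_set t M f \<inter> - A. f n)
        = (\<Sum>n\<in>level_set t M f. f n) - (\<Sum>n\<in>level_set t M f \<inter> A. f n)"
      by (simp add: sum_diff Diff_eq[symmetric] flip: Diff_Int2)
        (metis Int_commute finite_level_set sum.Int_Diff add_diff_cancel_left')
    then have "norm (\<Sum>n\<in>level_set t M f \<inter> - A. f n)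
        \<le> norm (\<Sum>n\<in>level_set t M f. f n) + norm (\<Sum>n\<in>level_set t M f \<inter> A. f n)"
      by (simp add: norm_triangle_ineq4)
    also have "\<dots> \<le> ?r + 2 * ?r" by (intro add_mono sum_le_level_norm sumA t)
    finally show "norm (\<Sum>n\<in>level_set t M (restr (- A) f). restr (- A) f n) \<le> 3 * ?r"
      by (simp add: L[OF t(1)] S)
  qed
qed

section \<open>The space of the example\<close>

interpretation level: monotone_seminorms
  "level_norm :: nat \<Rightarrow> (nat \<Rightarrow> 'f::{real_normed_field, banach}) \<Rightarrow> real" 30
  by (rule level_seminorms)

definition level_space :: "'f::{real_normed_field, banach} seq_qspace" where
  "level_space = seq_space level_norm"

definition level_envelope :: "'f::{real_normed_field, banach} seq_qspace" where
  "level_envelope = seq_space level.env_seminorm"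

lemma quasi_banach_level_space: "quasi_banach_space level_space"
  unfolding quasi_banach_space_def level_space_def
  using level.quasi_normed_seq_space level.complete_seq_space by blast

lemma locally_p_convex_level_space:
  assumes p: "0 < p" "p < 1"
  shows "locally_p_convex p (level_space :: 'f::{real_normed_field, banach} seq_qspace)"
  unfolding locally_p_convex_def
proof (intro exI[of _ "level_convexity_const p"] allI impI)
  fix J :: "nat set" and f :: "nat \<Rightarrow> nat \<Rightarrow> 'f"
  assume *: "finite J \<and> f ` J \<subseteq> carr level_space"
  have C: "0 \<le> level_convexity_const p"
    using weak_moment_const_pos[of "1 / p"] p by (simp add: level_convexity_const_def)
  have "qnorm (seq_space level_norm) (\<Sum>j\<in>J. f j)
      \<le> level_convexity_const p * (\<Sum>j\<in>J. qnorm (seq_space level_norm) (f j) powr p) powr (1 / p)"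
  proof (rule level.qnorm_le)
    fix N
    have "level_norm N (\<Sum>j\<in>J. f j)
        \<le> level_convexity_const p * (\<Sum>j\<in>J. level_norm N (f j) powr p) powr (1 / p)"
      using * p by (intro level_norm_sum_le) auto
    also have "\<dots> \<le> level_convexity_const p
        * (\<Sum>j\<in>J. qnorm (seq_space level_norm) (f j) powr p) powr (1 / p)"
      using * p C
      by (intro mult_left_mono powr_mono2 sum_mono sum_nonneg level.r_le_qnorm level_norm_nonneg)
        (auto simp: level_space_def)
    finally show "level_norm N (\<Sum>j\<in>J. f j) \<le> level_convexity_const p
        * (\<Sum>j\<in>J. qnorm (seq_space level_norm) (f j) powr p) powr (1 / p)" .
  qed
  then show "qnorm level_space (\<Sum>j\<in>J. f j)
      \<le> level_convexity_const p * (\<Sum>j\<in>J. qnorm level_space (f j) powr p) powr (1 / p)"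
    by (simp add: level_space_def)
qed

lemma schauder_basis_level_space: "schauder_basis level_space unit_seq"
  unfolding level_space_def by (rule level.schauder_basis_unit_seq)

text \<open>
  The lower half of democracy in the form needed below, where the part of a sequence on \<open>B - A\<close> is
  compared with its coefficients on \<open>A - B\<close>, which are larger and at least as many.
\<close>

lemma min_modulus_card_le_qnorm:
  fixes g :: "nat \<Rightarrow> 'f::{real_normed_field, banach}"
  assumes "g \<in> carr level_space" "finite D" "0 \<le> s" "\<And>n. n \<in> D \<Longrightarrow> s \<le> norm (g n)"
  shows "s * real (card D) \<le> qnorm level_space g"
proof (cases "s = 0")
  case True
  then show ?thesis using level.qnorm_nonneg[of g] assms(1) by (simp add: level_space_def)
next
  case False
  obtain M where M: "D \<subseteq> {..<M}" using assms(2) by (meson finite_nat_iff_bounded)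
  then have "D \<subseteq> level_set s M g" using assms(4) by (auto simp: level_set_def)
  then have "s * real (card D) \<le> s * real (card (level_set s M g))"
    using assms(3) by (intro mult_left_mono of_nat_mono card_mono) auto
  also have "\<dots> \<le> level_norm M g" using False assms(3) by (intro card_le_level_norm) auto
  also have "\<dots> \<le> qnorm level_space g"
    using level.r_le_qnorm assms(1) by (simp add: level_space_def)
  finally show ?thesis .
qed

text \<open>
  With \<open>g = f - S\<^sub>B f\<close>, the residual \<open>f - S\<^sub>A f\<close> is \<open>g\<close> without the set \<open>A - B\<close>, which is greedy for
  \<open>g\<close>, plus the part of \<open>f\<close> on \<open>B - A\<close>. The first is controlled by greedy projections being bounded
  and the second by democracy.
\<close>

lemma almost_greedy_level_space:
  "almost_greedy_basis (level_space :: 'f::{real_normed_field, banach} seq_qspace) unit_seq"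
  unfolding almost_greedy_basis_def
proof (intro exI[of _ "\<lambda>n f. f n"] conjI exI[of _ 120] ballI allI impI)
  let ?X = "level_space :: 'f seq_qspace"
  show "W_basis ?X unit_seq (\<lambda>n f. f n)"
    unfolding level_space_def by (rule level.W_basis_unit_seq)
  fix f :: "nat \<Rightarrow> 'f" and A B :: "nat set"
  assume f: "f \<in> carr ?X" and AB: "greedy_set (\<lambda>n f. f n) f A \<and> finite B \<and> card B \<le> card A"
  have fin: "finite A" "finite B" using AB by (auto simp: greedy_set_def)
  have greedy: "norm (f k) \<le> norm (f n)" if "n \<in> A" "k \<notin> A" for n k
    using AB that by (auto simp: greedy_set_def)
  have proj: "f - coord_proj ?X unit_seq (\<lambda>n f. f n) D f = restr (- D) f" if "finite D" for D :: "nat set"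
    using that by (simp add: coord_proj_def level_space_def sum_scale_unit_seq restr_Compl)
  note closed = level.carr_diff[folded level_space_def] level.restr_carr[folded level_space_def]
  define g where "g = restr (- B) f"
  have g: "g \<in> carr ?X" unfolding g_def restr_Compl using f fin closed by blast
  have split: "restr (- A) f = restr (- (A - B)) g + restr (B - A) f"
    by (auto simp: g_def restr_apply fun_eq_iff)
  have part1: "qnorm ?X (restr (- (A - B)) g) \<le> 3 * qnorm ?X g"
  proof -
    have "level_norm N (restr (- (A - B)) g) \<le> 3 * qnorm ?X g" for N
    proof -
      have "level_norm N (restr (- (A - B)) g) \<le> 3 * level_norm N g"
        using greedy by (intro level_norm_restr_greedy) (auto simp: g_def restr_apply)
      also have "\<dots> \<le> 3 * qnorm ?X g"
        using level.r_le_qnorm g by (simp add: level_space_def)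
      finally show ?thesis .
    qed
    then show ?thesis unfolding level_space_def by (intro level.qnorm_le)
  qed
  have part2: "qnorm ?X (restr (B - A) f) \<le> qnorm ?X g"
  proof (cases "B - A = {}")
    case True
    then have "restr (B - A) f = 0" by (auto simp: restr_apply fun_eq_iff)
    then show ?thesis
      using g by (simp add: level_space_def level.qnorm_zero level.qnorm_nonneg)
  next
    case False
    have cards: "card (B - A) \<le> card (A - B)"
      using AB fin card_Diff_subset_Int[of A B] card_Diff_subset_Int[of B A]
      by (simp add: Int_commute diff_le_mono)
    define s where "s = Max ((\<lambda>n. norm (f n)) ` (B - A))"
    have s: "norm (f k) \<le> s" if "k \<in> B - A" for k
      unfolding s_def using fin that by (intro Max_ge) auto
    have "s \<in> (\<lambda>n. norm (f n)) ` (B - A)" unfolding s_def using fin False by (intro Max_in) auto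
    then obtain k where k: "k \<in> B - A" "s = norm (f k)" by auto
    have "qnorm ?X (restr (B - A) f) \<le> (\<Sum>n\<in>B - A. norm (f n))"
      unfolding level_space_def using fin by (intro level.qnorm_restr_le) auto
    also have "\<dots> \<le> s * real (card (B - A))"
      using sum_mono[of "B - A" "\<lambda>n. norm (f n)" "\<lambda>_. s"] s by (simp add: mult.commute)
    also have "\<dots> \<le> s * real (card (A - B))" using cards k by (intro mult_left_mono) auto
    also have "\<dots> \<le> qnorm ?X g"
      using fin k greedy by (intro min_modulus_card_le_qnorm g) (auto simp: g_def restr_apply)
    finally show ?thesis .
  qed
  have "qnorm ?X (restr (- A) f)
      \<le> 30 * (qnorm ?X (restr (- (A - B)) g) + qnorm ?X (restr (B - A) f))"
    unfolding split
  proof (rule level.qnorm_add[folded level_space_def])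
    show "restr (- (A - B)) g \<in> carr ?X" unfolding restr_Compl using g fin closed by blast
    show "restr (B - A) f \<in> carr ?X" using fin closed by blast
  qed
  also have "\<dots> \<le> 30 * (3 * qnorm ?X g + qnorm ?X g)" using part1 part2 by simp
  also have "\<dots> = 120 * qnorm ?X g" by simp
  finally show "qnorm ?X (f - coord_proj ?X unit_seq (\<lambda>n f. f n) A f)
      \<le> 120 * qnorm ?X (f - coord_proj ?X unit_seq (\<lambda>n f. f n) B f)"
    using fin by (simp add: proj g_def)
qed

section \<open>The envelope of the example\<close>

text \<open>
  A threshold below all nonzero moduli keeps all the terms. This is where the sums in the
  quasi-norm yield bounded functionals whose coefficients are all equal to one.
\<close>

lemma partial_sum_le_level_norm: "norm (\<Sum>n<M. f n) \<le> level_norm M f"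
proof -
  define P where "P = {n. n < M \<and> f n \<noteq> 0}"
  have sum: "(\<Sum>n<M. f n) = (\<Sum>n\<in>P. f n)"
    by (rule sum.mono_neutral_right) (auto simp: P_def)
  show ?thesis
  proof (cases "P = {}")
    case True
    then show ?thesis using level_norm_nonneg by (simp add: sum)
  next
    case False
    define d where "d = Min ((\<lambda>n. norm (f n)) ` P)"
    have P: "finite P" by (simp add: P_def)
    have "d \<in> (\<lambda>n. norm (f n)) ` P" unfolding d_def using P False by (intro Min_in) auto
    then have d: "0 < d" by (auto simp: P_def)
    have "d \<le> norm (f n)" if "n \<in> P" for n unfolding d_def using P that by (intro Min_le) auto
    then have "P = level_set d M f" using d by (auto simp: P_def level_set_def)
    then show ?thesis using sum_le_level_norm[OF d order_refl[of M], of f] by (simp add: sum)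
  qed
qed

lemma banach_envelope_level_space: "banach_envelope level_space level_envelope id"
  unfolding level_space_def level_envelope_def by (rule level.banach_envelope_seq_space)

lemma qnorm_level_envelope: "f \<in> carr level_space \<Longrightarrow> qnorm level_envelope f = env_norm level_space f"
  unfolding level_space_def level_envelope_def by (rule level.qnorm_env)

lemma indicator_norms:
  assumes A: "finite A"
  shows "qnorm level_space (restr A (\<lambda>_. 1 :: 'f::{real_normed_field, banach})) = real (card A)"
    and "qnorm level_envelope (restr A (\<lambda>_. 1 :: 'f)) = real (card A)"
proof -
  let ?X = "level_space :: 'f seq_qspace" and ?f = "restr A (\<lambda>_. 1 :: 'f)"
  have f: "?f \<in> carr ?X" unfolding level_space_def using A by (rule level.restr_carr)
  have up: "qnorm ?X ?f \<le> real (card A)"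
    using level.qnorm_restr_le[OF A, of "\<lambda>_. 1 :: 'f"] by (simp add: level_space_def)
  obtain M where M: "A \<subseteq> {..<M}" using A by (meson finite_nat_iff_bounded)
  have "norm (\<Sum>n<M. ?f n) \<le> env_norm ?X ?f"
    unfolding level_space_def
  proof (rule level.functional_le_env_norm[where T = "\<lambda>f. \<Sum>n<M. f n"])
    show "linear_betw (seq_space level_norm) scalars (\<lambda>f :: nat \<Rightarrow> 'f. \<Sum>n<M. f n)"
      by (auto simp: linear_betw_def scalars_def sum.distrib sum_distrib_left)
    show "norm (\<Sum>n<M. f n) \<le> qnorm (seq_space level_norm) f"
      if "f \<in> carr (seq_space level_norm)" for f :: "nat \<Rightarrow> 'f"
      using partial_sum_le_level_norm[of f M] level.r_le_qnorm[OF that, of M] by linarith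
  qed (use f in \<open>simp add: level_space_def\<close>)
  also have "(\<Sum>n<M. ?f n) = of_nat (card A)"
    using M by (simp add: restr_apply sum.If_cases Int_absorb1)
  finally have low: "real (card A) \<le> env_norm ?X ?f" by simp
  have "env_norm ?X ?f \<le> qnorm ?X ?f"
    unfolding level_space_def
    by (rule env_norm_le[OF level.quasi_normed_seq_space]) (use f in \<open>simp add: level_space_def\<close>)
  then show "qnorm ?X ?f = real (card A)" "qnorm level_envelope ?f = real (card A)"
    using up low by (simp_all add: qnorm_level_envelope[OF f])
qed

text \<open>
  The pairs \<open>(1 / m, - 1 / m)\<close> for \<open>m = 1, \<dots>, L\<close>, arranged in cyclic order with a shift by \<open>i\<close>.
  Averaging over the shifts turns them into a multiple of the alternating sequence.
\<close>

definition paired_harmonic :: "nat \<Rightarrow> nat \<Rightarrow> nat \<Rightarrow> 'f::real_normed_field" where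
  "paired_harmonic L i n =
     (if n < 2 * L then (- 1) ^ n * of_real (inverse (real (Suc ((n div 2 + i) mod L)))) else 0)"

lemma inj_on_add_mod: "inj_on (\<lambda>k :: nat. (k + i) mod L) {..<L}"
proof (rule linorder_inj_onI')
  fix k l :: nat assume "k \<in> {..<L}" "l \<in> {..<L}" "k < l"
  then have "\<not> L dvd (l + i) - (k + i)" by (auto dest: dvd_imp_le)
  then show "(k + i) mod L \<noteq> (l + i) mod L"
    using \<open>k < l\<close> mod_eq_dvd_iff_nat[of "k + i" "l + i" L] by auto
qed

text \<open>
  The two members of a pair pass the same thresholds, so they cancel in every thresholded
  sum except for at most one unpaired term at the end. Only the weak \<open>\<ell>\<^sub>1\<close> part remains.
\<close>

lemma level_norm_paired_harmonic: "level_norm N (paired_harmonic L i :: nat \<Rightarrow> 'f::real_normed_field) \<le> 2"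
proof (rule level_normI)
  let ?h = "paired_harmonic L i :: nat \<Rightarrow> 'f"
  have norm_h: "norm (?h n) = (if n < 2 * L then inverse (real (Suc ((n div 2 + i) mod L))) else 0)" for n
    unfolding paired_harmonic_def by (simp add: norm_mult norm_power norm_inverse del: of_nat_Suc)
  fix t :: real and M assume t: "0 < t"
  let ?g = "\<lambda>n. ((n div 2 + i) mod L, n mod 2)"
  let ?k = "nat \<lfloor>1 / t\<rfloor>"
  have "inj_on ?g (level_set t M ?h)"
  proof (rule inj_onI)
    fix n m assume nm: "n \<in> level_set t M ?h" "m \<in> level_set t M ?h" "?g n = ?g m"
    then have "n < 2 * L" "m < 2 * L" using t by (auto simp: level_set_def norm_h split: if_splits)
    then have "n div 2 = m div 2"
      using nm(3) inj_onD[OF inj_on_add_mod[of i L], of "n div 2" "m div 2"] by auto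
    then show "n = m" using nm(3) by (metis div_mult_mod_eq prod.inject)
  qed
  then have "card (level_set t M ?h) = card (?g ` level_set t M ?h)" by (simp add: card_image)
  also have "\<dots> \<le> card ({..<?k} \<times> {..<2 :: nat})"
  proof (rule card_mono)
    show "?g ` level_set t M ?h \<subseteq> {..<?k} \<times> {..<2}"
    proof
      fix z assume "z \<in> ?g ` level_set t M ?h"
      then obtain n where n: "n \<in> level_set t M ?h" "z = ?g n" by blast
      let ?q = "(n div 2 + i) mod L"
      have "t \<le> inverse (real (Suc ?q))" using n t by (auto simp: level_set_def norm_h split: if_splits)
      then have "real (Suc ?q) \<le> 1 / t" using t by (simp add: field_simps del: of_nat_Suc)
      then have "Suc ?q \<le> ?k" by (simp add: le_nat_floor)
      then show "z \<in> {..<?k} \<times> {..<2}" by (simp add: n(2))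
    qed
  qed simp
  finally have "real (card (level_set t M ?h)) \<le> 2 * real ?k" by (simp add: card_cartesian_product)
  also have "\<dots> \<le> 2 * (1 / t)" using t by (intro mult_left_mono) auto
  finally show "t * real (card (level_set t M ?h)) \<le> 2" using t by (simp add: field_simps)
next
  let ?h = "paired_harmonic L i :: nat \<Rightarrow> 'f"
  fix t :: real and M assume t: "0 < t"
  define b where "b n = (if t \<le> norm (?h n) then ?h n else 0)" for n
  have pair: "?h (Suc (2 * k)) = - ?h (2 * k)" for k
    by (auto simp: paired_harmonic_def)
  have "b (Suc (2 * k)) = - b (2 * k)" for k by (simp add: b_def pair)
  then have even: "(\<Sum>n<2 * k. b n) = 0" for k by (induction k) auto
  have b1: "norm (b n) \<le> 1" for n
    by (auto simp: b_def paired_harmonic_def norm_mult norm_power norm_divide inverse_eq_divide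
        simp del: of_nat_Suc)
  have "(\<Sum>n\<in>level_set t M ?h. ?h n) = (\<Sum>n<M. b n)"
    by (rule sum.mono_neutral_cong_left) (auto simp: level_set_def b_def)
  moreover have "norm (\<Sum>n<M. b n) \<le> 1"
  proof (cases "even M")
    case True
    then obtain k where "M = 2 * k" by blast
    then show ?thesis using even by simp
  next
    case False
    then obtain k where "M = Suc (2 * k)" by (auto elim: oddE)
    then show ?thesis using even b1 by simp
  qed
  ultimately show "norm (\<Sum>n\<in>level_set t M ?h. ?h n) \<le> 2" by simp
qed

lemma sum_paired_harmonic:
  "(\<Sum>i<L. paired_harmonic L i)
    = seq_scale (of_real (harm L)) (restr {..<2 * L} (\<lambda>n. (- 1) ^ n :: 'f::real_normed_field))"
proof
  fix n
  show "(\<Sum>i<L. paired_harmonic L i) n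
    = seq_scale (of_real (harm L)) (restr {..<2 * L} (\<lambda>n. (- 1) ^ n :: 'f)) n"
  proof (cases "n < 2 * L")
    case True
    have inj: "inj_on (\<lambda>i. (n div 2 + i) mod L) {..<L}"
      using inj_on_add_mod[of "n div 2" L] by (simp add: add.commute)
    have "(\<lambda>i. (n div 2 + i) mod L) ` {..<L} = {..<L}"
      using True inj by (intro endo_inj_surj) auto
    then have "bij_betw (\<lambda>i. (n div 2 + i) mod L) {..<L} {..<L}" using inj by (simp add: bij_betw_def)
    then have "(\<Sum>i<L. inverse (real (Suc ((n div 2 + i) mod L)))) = harm L"
      unfolding harm_altdef by (rule sum.reindex_bij_betw)
    then have "(\<Sum>i<L. of_real (inverse (real (Suc ((n div 2 + i) mod L))))) = (of_real (harm L) :: 'f)"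
      by (metis of_real_sum)
    then have "(\<Sum>i<L. (- 1) ^ n * of_real (inverse (real (Suc ((n div 2 + i) mod L)))))
        = (- 1) ^ n * (of_real (harm L) :: 'f)"
      by (simp only: sum_distrib_left[symmetric])
    then show ?thesis
      using True by (simp only: sum_seq_apply paired_harmonic_def seq_scale_apply restr_apply)
        (simp add: mult.commute)
  qed (simp add: sum_seq_apply paired_harmonic_def restr_apply)
qed

text \<open>
  The \<open>L\<close> shifted sequences have quasi-norm at most two each, while their sum is \<open>harm L\<close> times the
  alternating sequence. Convexity of the envelope norm thus gains a factor of order \<open>ln L\<close>, which
  the quasi-norm itself does not.
\<close>

lemma env_norm_alternating_le:
  "harm L * env_norm level_space (restr {..<2 * L} (\<lambda>n. (- 1) ^ n :: 'f::{real_normed_field, banach}))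
    \<le> 2 * real L"
proof -
  let ?X = "seq_space level_norm :: 'f seq_qspace"
  note X = level.quasi_normed_seq_space
  have h: "paired_harmonic L i \<in> carr ?X" for i
  proof -
    have "paired_harmonic L i = restr {..<2 * L} (paired_harmonic L i :: nat \<Rightarrow> 'f)"
      by (auto simp: paired_harmonic_def restr_apply fun_eq_iff)
    then show ?thesis using level.head_carr by metis
  qed
  have "harm L * env_norm ?X (restr {..<2 * L} (\<lambda>n. (- 1) ^ n))
      = env_norm ?X (\<Sum>i<L. paired_harmonic L i)"
    unfolding sum_paired_harmonic
    using env_norm_scale[OF X level.head_carr, of "of_real (harm L) :: 'f"]
    by (simp add: harm_nonneg)
  also have "\<dots> \<le> (\<Sum>i<L. env_norm ?X (paired_harmonic L i))" by (rule env_norm_sum[OF X h])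
  also have "\<dots> \<le> (\<Sum>i<L. 2)"
    by (intro sum_mono order_trans[OF env_norm_le[OF X h]] level.qnorm_le level_norm_paired_harmonic)
  finally show ?thesis by (simp add: level_space_def)
qed

text \<open>
  Dropping the odd indices from the alternating sequence of length \<open>2 * L\<close> leaves \<open>L\<close> equal signs.
  The norm goes up from at most \<open>2 * L / harm L\<close> to \<open>L\<close>, and the harmonic numbers are unbounded.
\<close>

lemma not_unconditional_level_envelope:
  "\<not> unconditional_const_coeffs (level_envelope :: 'f::{real_normed_field, banach} seq_qspace) (id \<circ> unit_seq)"
proof
  let ?E = "level_envelope :: 'f seq_qspace"
  assume "unconditional_const_coeffs ?E (id \<circ> unit_seq)"
  then obtain C where C: "\<forall>A B. \<forall>\<epsilon> :: nat \<Rightarrow> 'f.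
      finite B \<and> A \<subseteq> B \<and> (\<forall>n\<in>B. norm (\<epsilon> n) = 1) \<longrightarrow>
      qnorm ?E (\<Sum>n\<in>A. scal ?E (\<epsilon> n) (unit_seq n))
        \<le> C * qnorm ?E (\<Sum>n\<in>B. scal ?E (\<epsilon> n) (unit_seq n))"
    unfolding unconditional_const_coeffs_def comp_apply id_apply by (elim exE)
  have "eventually (\<lambda>L. 2 * \<bar>C\<bar> < harm L) sequentially"
    using harm_at_top by (simp add: filterlim_at_top_dense)
  then obtain L0 where L0: "\<And>L. L0 \<le> L \<Longrightarrow> 2 * \<bar>C\<bar> < harm L" by (auto simp: eventually_sequentially)
  define L where "L = Suc L0"
  have H: "2 * \<bar>C\<bar> < harm L" using L0 by (simp add: L_def)
  define \<epsilon> where "\<epsilon> n = ((- 1) ^ n :: 'f)" for n :: nat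
  define A where "A = (\<lambda>k. 2 * k) ` {..<L}"
  have A: "finite A" "card A = L" "A \<subseteq> {..<2 * L}" by (auto simp: A_def card_image inj_on_def)
  have scal: "scal ?E = seq_scale" by (simp add: level_envelope_def seq_space_def)
  have "restr A \<epsilon> = restr A (\<lambda>_. 1)" by (auto simp: \<epsilon>_def A_def restr_apply fun_eq_iff)
  then have "real L = qnorm ?E (\<Sum>n\<in>A. scal ?E (\<epsilon> n) (unit_seq n))"
    using indicator_norms(2)[OF A(1), where ?'f = 'f] A by (simp add: scal sum_scale_unit_seq)
  also have "\<dots> \<le> C * qnorm ?E (\<Sum>n\<in>{..<2 * L}. scal ?E (\<epsilon> n) (unit_seq n))"
    using A by (intro C[rule_format]) (simp add: \<epsilon>_def norm_power)
  also have "(\<Sum>n\<in>{..<2 * L}. scal ?E (\<epsilon> n) (unit_seq n)) = restr {..<2 * L} \<epsilon>"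
    by (simp add: scal sum_scale_unit_seq)
  also have "qnorm ?E (restr {..<2 * L} \<epsilon>) = env_norm level_space (restr {..<2 * L} \<epsilon>)"
    by (rule qnorm_level_envelope) (simp add: level_space_def level.head_carr)
  finally have "real L \<le> C * env_norm level_space (restr {..<2 * L} \<epsilon>)" .
  also have "\<dots> \<le> \<bar>C\<bar> * env_norm level_space (restr {..<2 * L} \<epsilon>)"
    unfolding level_space_def
    by (intro mult_right_mono env_norm_nonneg[OF level.quasi_normed_seq_space level.head_carr]) simp
  finally have "harm L * real L \<le> harm L * (\<bar>C\<bar> * env_norm level_space (restr {..<2 * L} \<epsilon>))"
    by (intro mult_left_mono harm_nonneg)
  also have "\<dots> = \<bar>C\<bar> * (harm L * env_norm level_space (restr {..<2 * L} \<epsilon>))" by (simp add: mult.left_commute)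
  also have "\<dots> \<le> \<bar>C\<bar> * (2 * real L)"
    unfolding \<epsilon>_def by (intro mult_left_mono env_norm_alternating_le) simp
  finally have "harm L * real L \<le> (2 * \<bar>C\<bar>) * real L" by simp
  then have "harm L \<le> 2 * \<bar>C\<bar>" by (simp add: L_def)
  then show False using H by simp
qed

lemma sum_unit_seq:
  fixes A :: "'i set"
  assumes "finite A"
  shows "(\<Sum>n\<in>A. unit_seq n) = restr A (\<lambda>_. 1 :: 'f::semiring_1)"
proof -
  from assms have "(\<Sum>n\<in>A. seq_scale 1 (unit_seq n)) = restr A (\<lambda>_. 1 :: 'f)" by (rule sum_scale_unit_seq)
  moreover have "seq_scale 1 f = f" for f :: "'i \<Rightarrow> 'f" by auto
  ultimately show ?thesis by simp
qed

lemma democratic_level_envelope: "democratic level_envelope (id \<circ> unit_seq)"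
  unfolding democratic_def by (auto simp: sum_unit_seq indicator_norms intro!: exI[of _ 1])

theorem level_space_example:
  "\<exists>(X :: 'f::{real_normed_field, banach} seq_qspace) x (E :: 'f seq_qspace) J.
      quasi_banach_space X \<and> almost_greedy_basis X x \<and> schauder_basis X x \<and>
      banach_envelope X E J \<and>
      democratic E (J \<circ> x) \<and> \<not> unconditional_const_coeffs E (J \<circ> x) \<and>
      (\<exists>c C. 0 < c \<and> c \<le> C \<and> (\<forall>A. finite A \<longrightarrow>
         c * real (card A) \<le> qnorm X (\<Sum>n\<in>A. x n) \<and> qnorm X (\<Sum>n\<in>A. x n) \<le> C * real (card A) \<and>
         c * real (card A) \<le> qnorm E (\<Sum>n\<in>A. J (x n)) \<and> qnorm E (\<Sum>n\<in>A. J (x n)) \<le> C * real (card A))) \<and>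
      (\<forall>p. 0 < p \<and> p < 1 \<longrightarrow> locally_p_convex p X)"
proof -
  have bounds: "\<exists>c C :: real. 0 < c \<and> c \<le> C \<and> (\<forall>A. finite A \<longrightarrow>
      c * real (card A) \<le> qnorm (level_space :: 'f seq_qspace) (\<Sum>n\<in>A. unit_seq n) \<and>
      qnorm (level_space :: 'f seq_qspace) (\<Sum>n\<in>A. unit_seq n) \<le> C * real (card A) \<and>
      c * real (card A) \<le> qnorm (level_envelope :: 'f seq_qspace) (\<Sum>n\<in>A. id (unit_seq n)) \<and>
      qnorm (level_envelope :: 'f seq_qspace) (\<Sum>n\<in>A. id (unit_seq n)) \<le> C * real (card A))"
    by (intro exI[of _ 1]) (simp add: sum_unit_seq indicator_norms)
  show ?thesis
    by (rule exI[of _ level_space], rule exI[of _ unit_seq], rule exI[of _ level_envelope],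
        rule exI[of _ id], intro conjI quasi_banach_level_space almost_greedy_level_space
        schauder_basis_level_space banach_envelope_level_space democratic_level_envelope
        not_unconditional_level_envelope bounds)
      (auto intro: locally_p_convex_level_space)
qed

theorem theorem3p17:
  shows "(\<exists>(X :: real seq_qspace) x (E :: real seq_qspace) J.
      quasi_banach_space X \<and> almost_greedy_basis X x \<and> schauder_basis X x \<and>
      banach_envelope X E J \<and>
      democratic E (J \<circ> x) \<and> \<not> unconditional_const_coeffs E (J \<circ> x) \<and>
      (\<exists>c C. 0 < c \<and> c \<le> C \<and> (\<forall>A. finite A \<longrightarrow>
         c * real (card A) \<le> qnorm X (\<Sum>n\<in>A. x n) \<and> qnorm X (\<Sum>n\<in>A. x n) \<le> C * real (card A) \<and>
         c * real (card A) \<le> qnorm E (\<Sum>n\<in>A. J (x n)) \<and> qnorm E (\<Sum>n\<in>A. J (x n)) \<le> C * real (card A))) \<and>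
      (\<forall>p. 0 < p \<and> p < 1 \<longrightarrow> locally_p_convex p X))
    \<and>
    (\<exists>(X :: complex seq_qspace) x (E :: complex seq_qspace) J.
      quasi_banach_space X \<and> almost_greedy_basis X x \<and> schauder_basis X x \<and>
      banach_envelope X E J \<and>
      democratic E (J \<circ> x) \<and> \<not> unconditional_const_coeffs E (J \<circ> x) \<and>
      (\<exists>c C. 0 < c \<and> c \<le> C \<and> (\<forall>A. finite A \<longrightarrow>
         c * real (card A) \<le> qnorm X (\<Sum>n\<in>A. x n) \<and> qnorm X (\<Sum>n\<in>A. x n) \<le> C * real (card A) \<and>
         c * real (card A) \<le> qnorm E (\<Sum>n\<in>A. J (x n)) \<and> qnorm E (\<Sum>n\<in>A. J (x n)) \<le> C * real (card A))) \<and>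
      (\<forall>p. 0 < p \<and> p < 1 \<longrightarrow> locally_p_convex p X))"
  by (intro conjI level_space_example)

end
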